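(* Let $G$ be a simple connected bipartite graph on vertex set $[n]$ with Laplacian matrix $L_G$. Then for all $\lambda\vdash n$ and all $0\le r\le n$, $$b_{\lambda,r}(L_G)=\sum_{\mu\in P(n)}a_{G,r}(\mu)\,\alpha_{\lambda,\mu}.$$ In particular, $b_{\lambda,r}(L_G)$ is a non-negative integer for all $\lambda\vdash n$ and $r=0,1,\dots,n$.
   Context: $P(n)$ is the set of partitions of $n$. For $\lambda\vdash n$, $\chi_\lambda$ is the irreducible complex character of the symmetric group $\mathfrak{S}_n$ indexed by $\lambda$, and $\chi_\lambda(\nu)$ is its value on permutations of cycle type $\nu$. The immanant is $\mathrm{imm}_\lambda(A)=\sum_{\psi\in\mathfrak{S}_n}\chi_\lambda(\psi)\prod_{i=1}^n a_{i,\psi(i)}$. The Laplacian is $L_G=D-A(G)$ ($D$ the diagonal degree matrix, $A(G)$ the adjacency matrix), and $b_{\lambda,r}(L_G)$ is defined by $\mathrm{imm}_\lambda(xI-L_G)=\sum_{r=0}^n(-1)^r b_{\lambda,r}(L_G)x^{n-r}$. For $\mu=(1^{n_1},2^{n_2},\dots,n^{n_n})$ and $\nu=(1^{m_1},2^{m_2},\dots,n^{m_n})$ in $P(n)$ (exponents are multiplicities), set $\binom{\mu}{\nu}=\binom{n_2}{m_2}\binom{n_3}{m_3}\cdots\binom{n_n}{m_n}$ (parts equal to 1 are not used; $\binom{a}{b}=0$ if $a<b$), and $\alpha_{\lambda,\mu}=\sum_{\nu\in P(n)}\chi_\lambda(\nu)\binom{\mu}{\nu}$. For $B\subseteq[n]$,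 a $B$-orientation $O$ of $G$ assigns to each vertex $v\in B$ one neighbour $O(v)$ of $v$ in $G$ (an arrow on the edge $\{v,O(v)\}$ pointing away from $v$; $O(v)$ need not be in $B$). The type of $O$ is the partition $\mu=(1^{n_1},2^{n_2},4^{n_4},6^{n_6},\dots)$ of $n$ in which $n_2$ is the number of edges carrying two arrows (bidirected edges), $n_{2j}$ for $j\ge2$ is the number of directed cycles of length $2j$ formed by the arrows, and $n_1=n-2n_2-4n_4-6n_6-\cdots$. $a_{G,r}(\mu)$ is the total number of $B$-orientations of $G$ of type $\mu$, over all $B\subseteq[n]$ with $|B|=r$. *)

theory Defs
  imports
    "HOL-Combinatorics.Combinatorics"
    "HOL-Computational_Algebra.Polynomial"
    "HOL-Library.FuncSet"
    "HOL-Library.Function_Algebras"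
    Complex_Main
begin

definition partitions :: "nat \<Rightarrow> nat multiset set" where
  "partitions n = {lam. 0 \<notin># lam \<and> sum_mset lam = n}"

definition rows :: "nat multiset \<Rightarrow> nat list" where
  "rows lam = rev (sorted_list_of_multiset lam)"

definition cycle_type :: "nat \<Rightarrow> (nat \<Rightarrow> nat) \<Rightarrow> nat multiset" where
  "cycle_type n \<sigma> = image_mset card (mset_set (orbit \<sigma> ` {1..n}))"

definition cscale :: "complex \<Rightarrow> ('b \<Rightarrow> complex) \<Rightarrow> 'b \<Rightarrow> complex" where
  "cscale c f = (\<lambda>x. c * f x)"

interpretation cfun: vector_space cscale
  by unfold_locales (auto simp: cscale_def algebra_simps fun_eq_iff)

text \<open>The trace of a linear map \<open>F\<close> on a finite-dimensional \<open>F\<close>-invariant subspace \<open>V\<close>: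
  the sum of the diagonal matrix entries with respect to a basis of \<open>V\<close>.\<close>

definition trace_on ::
  "('b \<Rightarrow> complex) set \<Rightarrow> (('b \<Rightarrow> complex) \<Rightarrow> ('b \<Rightarrow> complex)) \<Rightarrow> complex" where
  "trace_on V F =
     (let B = (SOME B. B \<subseteq> V \<and> cfun.independent B \<and> cfun.span B = V)
      in \<Sum>b\<in>B. cfun.representation B (F b) b)"

definition cells :: "nat multiset \<Rightarrow> (nat \<times> nat) set" where
  "cells lam = {(i, j). i < length (rows lam) \<and> j < rows lam ! i}"

definition tableaux :: "nat \<Rightarrow> nat multiset \<Rightarrow> (nat \<times> nat \<Rightarrow> nat) set" where
  "tableaux n lam = {t. bij_betw t (cells lam) {1..n}}"

text \<open>A tabloid (row equivalence class of tableaux) is represented by the list of the sets of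
  entries of its rows.\<close>

definition tabloid :: "nat multiset \<Rightarrow> (nat \<times> nat \<Rightarrow> nat) \<Rightarrow> nat set list" where
  "tabloid lam t =
     map (\<lambda>i. (\<lambda>j. t (i, j)) ` {..<rows lam ! i}) [0..<length (rows lam)]"

definition column_stabilizer ::
  "nat \<Rightarrow> nat multiset \<Rightarrow> (nat \<times> nat \<Rightarrow> nat) \<Rightarrow> (nat \<Rightarrow> nat) set" where
  "column_stabilizer n lam t =
     {\<pi>. \<pi> permutes {1..n} \<and>
         (\<forall>(i, j)\<in>cells lam. \<exists>i'. (i', j) \<in> cells lam \<and> \<pi> (t (i, j)) = t (i', j))}"

text \<open>Elements of the permutation module on tabloids are written as coefficient functions; the
  polytabloid of \<open>t\<close> is the signed sum of the tabloids of \<open>\<pi> \<circ> t\<close>, for \<open>\<pi>\<close> in the column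
  stabilizer of \<open>t\<close>.\<close>

definition polytabloid ::
  "nat \<Rightarrow> nat multiset \<Rightarrow> (nat \<times> nat \<Rightarrow> nat) \<Rightarrow> nat set list \<Rightarrow> complex" where
  "polytabloid n lam t =
     (\<lambda>T. \<Sum>\<pi>\<in>column_stabilizer n lam t.
        of_int (sign \<pi>) * (if tabloid lam (\<pi> \<circ> t) = T then 1 else 0))"

definition specht :: "nat \<Rightarrow> nat multiset \<Rightarrow> (nat set list \<Rightarrow> complex) set" where
  "specht n lam = cfun.span (polytabloid n lam ` tableaux n lam)"

text \<open>The linear action which maps the basis vector of a tabloid \<open>T\<close> to that of \<open>\<sigma> T\<close>, so that
  coefficients are pulled back along the inverse of \<open>\<sigma>\<close>.\<close>

definition perm_act ::
  "(nat \<Rightarrow> nat) \<Rightarrow> (nat set list \<Rightarrow> complex) \<Rightarrow> nat set list \<Rightarrow> complex" where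
  "perm_act \<sigma> f = (\<lambda>T. f (map ((`) (inv \<sigma>)) T))"

definition irr_char :: "nat \<Rightarrow> nat multiset \<Rightarrow> (nat \<Rightarrow> nat) \<Rightarrow> complex" where
  "irr_char n lam \<sigma> = trace_on (specht n lam) (perm_act \<sigma>)"

definition irr_char_type :: "nat \<Rightarrow> nat multiset \<Rightarrow> nat multiset \<Rightarrow> complex" where
  "irr_char_type n lam \<nu> =
     irr_char n lam (SOME \<sigma>. \<sigma> permutes {1..n} \<and> cycle_type n \<sigma> = \<nu>)"

text \<open>An \<open>n \<times> n\<close> matrix is a function of which only the entries with indices in \<open>{1..n}\<close> matter.\<close>

definition imm :: "nat \<Rightarrow> nat multiset \<Rightarrow> (nat \<Rightarrow> nat \<Rightarrow> complex) \<Rightarrow> complex" where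
  "imm n lam A = (\<Sum>\<psi> | \<psi> permutes {1..n}. irr_char n lam \<psi> * (\<Prod>i = 1..n. A i (\<psi> i)))"

definition x_minus :: "complex \<Rightarrow> (nat \<Rightarrow> nat \<Rightarrow> complex) \<Rightarrow> nat \<Rightarrow> nat \<Rightarrow> complex" where
  "x_minus x A = (\<lambda>i j. (if i = j then x else 0) - A i j)"

text \<open>The sequence of coefficients of the immanantal polynomial, padded by zeros beyond \<open>n\<close>.\<close>

definition imm_coeff ::
  "nat \<Rightarrow> nat multiset \<Rightarrow> (nat \<Rightarrow> nat \<Rightarrow> complex) \<Rightarrow> nat \<Rightarrow> complex" where
  "imm_coeff n lam A =
     (THE b. (\<forall>x. imm n lam (x_minus x A) = (\<Sum>r = 0..n. (-1) ^ r * b r * x ^ (n - r))) \<and>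
             (\<forall>r>n. b r = 0))"

lemma imm_coeff_unique_existence:
  "\<exists>!b. (\<forall>x. imm n lam (x_minus x A) = (\<Sum>r = 0..n. (-1) ^ r * b r * x ^ (n - r))) \<and>
        (\<forall>r>n. b r = 0)"
proof -
  define Q where "Q = (\<lambda>\<psi>. \<Prod>i = 1..n. [:- A i (\<psi> i), if i = \<psi> i then 1 else 0:])"
  define P where "P = (\<Sum>\<psi> | \<psi> permutes {1..n}. smult (irr_char n lam \<psi>) (Q \<psi>))"
  have "degree (Q \<psi>) \<le> n" for \<psi>
  proof -
    have "degree (Q \<psi>) \<le> sum (degree \<circ> (\<lambda>i. [:- A i (\<psi> i), if i = \<psi> i then 1 else 0:])) {1..n}"
      unfolding Q_def by (rule degree_prod_sum_le) simp
    also have "\<dots> \<le> (\<Sum>i = 1..n. 1)"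
      by (intro sum_mono) auto
    finally show ?thesis by simp
  qed
  then have deg: "degree P \<le> n"
    unfolding P_def by (intro degree_sum_le finite_permutations)
      (auto intro: order.trans[OF degree_smult_le])
  have poly: "imm n lam (x_minus x A) = poly P x" for x
    unfolding imm_def P_def Q_def x_minus_def poly_sum poly_smult poly_prod
    by (intro sum.cong prod.cong arg_cong2[where f = "(*)"]) auto
  have reindex: "(\<Sum>r = 0..n. (-1) ^ r * b r * x ^ (n - r)) =
      poly (\<Sum>i\<le>n. monom ((-1) ^ (n - i) * b (n - i)) i) x" for b and x :: complex
    unfolding poly_sum poly_monom
    by (rule sum.reindex_bij_witness[of _ "\<lambda>i. n - i" "\<lambda>i. n - i"]) auto
  show ?thesis
  proof (rule ex1I[of _ "\<lambda>r. if r \<le> n then (-1) ^ r * coeff P (n - r) else 0"], goal_cases)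
    case 1
    have "poly P x = (\<Sum>r = 0..n. coeff P (n - r) * x ^ (n - r))" for x
    proof -
      have "poly P x = (\<Sum>i\<le>n. coeff P i * x ^ i)"
        unfolding poly_altdef using deg by (intro sum.mono_neutral_left) (auto simp: coeff_eq_0)
      also have "\<dots> = (\<Sum>r = 0..n. coeff P (n - r) * x ^ (n - r))"
        by (rule sum.reindex_bij_witness[of _ "\<lambda>i. n - i" "\<lambda>i. n - i"]) auto
      finally show ?thesis .
    qed
    then show ?case
      unfolding poly by (auto intro!: sum.cong simp flip: mult.assoc power_add)
  next
    case (2 b)
    then have "poly P x = poly (\<Sum>i\<le>n. monom ((-1) ^ (n - i) * b (n - i)) i) x" for x
      using poly reindex by metis
    then have "P = (\<Sum>i\<le>n. monom ((-1) ^ (n - i) * b (n - i)) i)"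
      by (simp add: poly_eq_poly_eq_iff fun_eq_iff flip: poly_eq_poly_eq_iff)
    then have "coeff P (n - r) = (-1) ^ r * b r" if "r \<le> n" for r
      using that by (simp add: coeff_sum)
    then show ?case
      using 2 by (auto simp: fun_eq_iff simp flip: mult.assoc power_add)
  qed
qed

definition simple_graph :: "nat \<Rightarrow> nat set set \<Rightarrow> bool" where
  "simple_graph n E \<longleftrightarrow> (\<forall>e\<in>E. e \<subseteq> {1..n} \<and> card e = 2)"

definition connected_graph :: "nat \<Rightarrow> nat set set \<Rightarrow> bool" where
  "connected_graph n E \<longleftrightarrow> (\<forall>u\<in>{1..n}. \<forall>v\<in>{1..n}. (u, v) \<in> {(x, y). {x, y} \<in> E}\<^sup>*)"

definition bipartite_graph :: "nat \<Rightarrow> nat set set \<Rightarrow> bool" where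
  "bipartite_graph n E \<longleftrightarrow>
     (\<exists>X Y. X \<union> Y = {1..n} \<and> X \<inter> Y = {} \<and> (\<forall>e\<in>E. \<exists>x\<in>X. \<exists>y\<in>Y. e = {x, y}))"

definition neighbours :: "nat set set \<Rightarrow> nat \<Rightarrow> nat set" where
  "neighbours E v = {w. {v, w} \<in> E}"

definition adjacency :: "nat set set \<Rightarrow> nat \<Rightarrow> nat \<Rightarrow> complex" where
  "adjacency E = (\<lambda>i j. if {i, j} \<in> E then 1 else 0)"

definition degree_matrix :: "nat set set \<Rightarrow> nat \<Rightarrow> nat \<Rightarrow> complex" where
  "degree_matrix E = (\<lambda>i j. if i = j then of_nat (card (neighbours E i)) else 0)"

definition laplacian :: "nat set set \<Rightarrow> nat \<Rightarrow> nat \<Rightarrow> complex" where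
  "laplacian E = (\<lambda>i j. degree_matrix E i j - adjacency E i j)"

definition orientations :: "nat set set \<Rightarrow> nat set \<Rightarrow> (nat \<Rightarrow> nat) set" where
  "orientations E B = (\<Pi>\<^sub>E v\<in>B. neighbours E v)"

definition bidirected_edges :: "nat set set \<Rightarrow> nat set \<Rightarrow> (nat \<Rightarrow> nat) \<Rightarrow> nat set set" where
  "bidirected_edges E B f = {e\<in>E. \<exists>u\<in>B. \<exists>v\<in>B. e = {u, v} \<and> f u = v \<and> f v = u}"

text \<open>A directed cycle is given by its set of arrows.\<close>

definition directed_cycles :: "nat set \<Rightarrow> (nat \<Rightarrow> nat) \<Rightarrow> nat \<Rightarrow> (nat \<times> nat) set set" where
  "directed_cycles B f k =
     {(\<lambda>v. (v, f v)) ` set vs | vs.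
        length vs = k \<and> distinct vs \<and> set vs \<subseteq> B \<and>
        (\<forall>i<k. f (vs ! i) = vs ! (Suc i mod k))}"

definition orientation_type ::
  "nat \<Rightarrow> nat set set \<Rightarrow> nat set \<Rightarrow> (nat \<Rightarrow> nat) \<Rightarrow> nat multiset" where
  "orientation_type n E B f =
     (let n2 = card (bidirected_edges E B f);
          c = (\<lambda>j. card (directed_cycles B f (2 * j)));
          n1 = n - 2 * n2 - (\<Sum>j = 2..n. 2 * j * c j)
      in replicate_mset n1 1 + replicate_mset n2 2 +
         (\<Sum>j = 2..n. replicate_mset (c j) (2 * j)))"

definition orientation_count :: "nat \<Rightarrow> nat set set \<Rightarrow> nat \<Rightarrow> nat multiset \<Rightarrow> nat" where
  "orientation_count n E r \<mu> =
     (\<Sum>B | B \<subseteq> {1..n} \<and> card B = r.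
        card {f \<in> orientations E B. orientation_type n E B f = \<mu>})"

definition partition_binomial :: "nat \<Rightarrow> nat multiset \<Rightarrow> nat multiset \<Rightarrow> nat" where
  "partition_binomial n \<mu> \<nu> = (\<Prod>j = 2..n. count \<mu> j choose count \<nu> j)"

definition alpha :: "nat \<Rightarrow> nat multiset \<Rightarrow> nat multiset \<Rightarrow> complex" where
  "alpha n lam \<mu> =
     (\<Sum>\<nu>\<in>partitions n. irr_char_type n lam \<nu> * of_nat (partition_binomial n \<mu> \<nu>))"

end

theory Submission
  imports Defs
begin

text \<open>The coefficient \<open>b\<^sub>\<lambda>\<^sub>,\<^sub>r\<close> turns out to be a sum of character values over pairs of an orientation and a set of
  its directed cycles. Both claims then become statements about the cycles of one orientation.

  \<^emph>\<open>Expansion.\<close> In \<open>imm (xI - L)\<close>, pick for each permutation \<open>\<psi>\<close> the set \<open>B\<close> of rows in which the entry of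
  \<open>-L\<close> rather than \<open>x\<close> is used. It contains the points moved by \<open>\<psi>\<close>, each of which needs the edge from
  \<open>i\<close> to \<open>\<psi> i\<close>; a fixed point in \<open>B\<close> contributes its degree, which is the number of possible arrows
  at this vertex. So the product counts, up to sign, the \<open>B\<close>-orientations \<open>f\<close> that agree with \<open>\<psi>\<close> on
  its moved points. Since the graph is bipartite, \<open>\<psi>\<close> moves an even number of points, and the only sign
  left is \<open>(-1)\<^sup>r\<close> with \<open>r = |B|\<close>. Exchanging the sums, \<open>b\<^sub>\<lambda>\<^sub>,\<^sub>r\<close> is the sum over all orientations \<open>f\<close>
  with \<open>r\<close> arrows of the values \<open>\<chi>(\<psi>)\<close>, where \<open>\<psi>\<close> runs through the permutations that follow \<open>f\<close>
  wherever they move (\<open>imm_coeff_laplacian\<close>).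

  \<^emph>\<open>The formula.\<close> Such permutations are the products \<open>g\<^sub>S\<close> of sets \<open>S\<close> of directed cycles of \<open>f\<close>
  (\<open>bij_betw_union_perm\<close>), a bidirected edge being a cycle of length 2. Selecting \<open>S\<close> with
  \<open>g\<^sub>S\<close> of cycle type \<open>\<nu>\<close> means selecting, for each \<open>j \<ge> 2\<close>, as many cycles of length \<open>j\<close> as \<open>\<nu>\<close> has
  parts \<open>j\<close>. The number of these \<open>S\<close> is the binomial product of the type of \<open>f\<close> and \<open>\<nu>\<close>, and \<open>\<chi>\<close>
  is a class function (\<open>irr_char_cong_cycle_type\<close>), so the inner sum is \<open>\<alpha>\<close> at the type of \<open>f\<close> (\<open>alpha_orientation_type\<close>).

  \<^emph>\<open>Non-negativity.\<close> A character is positive definite, so \<open>\<Sum>S T. \<chi>(g\<^sub>S g\<^sub>T\<inverse>) \<ge> 0\<close>. As a cycle and its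
  inverse have the same orbits, \<open>g\<^sub>S g\<^sub>T\<inverse>\<close> has the cycle type of the product of the cycles in the symmetric
  difference of \<open>S\<close> and \<open>T\<close>. With \<open>k\<close> cycles in total the double sum is therefore
  \<open>2\<^sup>k \<Sum>S. \<chi>(g\<^sub>S)\<close>, whence the inner sum is non-negative
  (\<open>sum_irr_char_sub_permutations_nonneg\<close>).

  \<^emph>\<open>Integrality.\<close> The polytabloids have integer coefficients, and the integer-valued functions in a Specht
  module form an invariant lattice that spans it. In a lattice basis every permutation acts by an
  integral matrix (\<open>trace_on_in_Ints\<close>).\<close>

section \<open>Traces on finite-dimensional spaces of functions\<close>

definition supported_on :: "'b set \<Rightarrow> ('b \<Rightarrow> complex) set" where
  "supported_on X = {f. \<forall>x. x \<notin> X \<longrightarrow> f x = 0}"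

abbreviation clinear_op :: "(('b \<Rightarrow> complex) \<Rightarrow> ('b \<Rightarrow> complex)) \<Rightarrow> bool" where
  "clinear_op \<equiv> Vector_Spaces.linear cscale cscale"

lemma sum_fun_apply: "(\<Sum>i\<in>I. f i) x = (\<Sum>i\<in>I. f i x)" for f :: "'i \<Rightarrow> 'b \<Rightarrow> complex"
  by (induction I rule: infinite_finite_induct) auto

text \<open>The function type is infinite-dimensional; all spaces below consist of functions that vanish
  outside one fixed finite set, and this is what bounds their dimension.\<close>

lemma finite_independent_supported_on:
  assumes "finite X" "cfun.independent B" "B \<subseteq> supported_on X"
  shows "finite B"
proof -
  define \<delta> :: "'a \<Rightarrow> 'a \<Rightarrow> complex" where "\<delta> = (\<lambda>x y. if x = y then 1 else 0)"
  have "f \<in> cfun.span (\<delta> ` X)" if "f \<in> B" for f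
  proof -
    have "f = (\<Sum>x\<in>X. cscale (f x) (\<delta> x))"
    proof
      fix y
      have "(\<Sum>x\<in>X. cscale (f x) (\<delta> x)) y = (\<Sum>x\<in>X. if x = y then f x else 0)"
        unfolding sum_fun_apply cscale_def \<delta>_def by (intro sum.cong) auto
      then show "f y = (\<Sum>x\<in>X. cscale (f x) (\<delta> x)) y"
        using that assms by (auto simp: supported_on_def)
    qed
    also have "\<dots> \<in> cfun.span (\<delta> ` X)"
      by (intro cfun.span_sum cfun.span_scale cfun.span_base) auto
    finally show ?thesis .
  qed
  then show ?thesis
    using cfun.independent_span_bound[of "\<delta> ` X" B] assms by auto
qed

lemma linear_sum_representation:
  assumes F: "clinear_op F" and B: "finite B" "cfun.independent B" and v: "v \<in> cfun.span B"
  shows "F v = (\<Sum>b\<in>B. cscale (cfun.representation B v b) (F b))"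
proof -
  interpret F: Vector_Spaces.linear cscale cscale F by fact
  have "v = (\<Sum>b\<in>B. cscale (cfun.representation B v b) b)"
    using cfun.sum_representation_eq[OF B(2) v B(1)] by simp
  then have "F v = F (\<Sum>b\<in>B. cscale (cfun.representation B v b) b)"
    by simp
  then show ?thesis
    by (simp only: F.sum F.scale)
qed

text \<open>With \<open>f\<^sub>b\<^sub>c\<close> and \<open>g\<^sub>c\<^sub>b\<close> the matrix entries of the two operators between the bases \<open>B\<close> and \<open>C\<close>, both
  sides are the same double sum of the products \<open>f\<^sub>b\<^sub>c g\<^sub>c\<^sub>b\<close>. Allowing two bases at once makes the
  independence of the trace from the basis the special case in which one operator is the identity.\<close>

lemma representation_trace_comm:
  assumes F: "clinear_op F" "F ` V \<subseteq> V" and G: "clinear_op G" "G ` V \<subseteq> V"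
    and B: "finite B" "cfun.independent B" "cfun.span B = V"
    and C: "finite C" "cfun.independent C" "cfun.span C = V"
  shows "(\<Sum>b\<in>B. cfun.representation B (F (G b)) b) =
         (\<Sum>c\<in>C. cfun.representation C (G (F c)) c)"
proof -
  have expand: "cfun.representation B' (F' (G' b)) b =
      (\<Sum>c\<in>C'. cfun.representation C' (G' b) c * cfun.representation B' (F' c) b)"
    if F': "clinear_op F'" "F' ` V \<subseteq> V" and G': "G' ` V \<subseteq> V"
      and B': "finite B'" "cfun.independent B'" "cfun.span B' = V"
      and C': "finite C'" "cfun.independent C'" "cfun.span C' = V" and b: "b \<in> B'"
    for F' G' B' C' b
  proof -
    have V: "b \<in> V" "\<And>c. c \<in> C' \<Longrightarrow> F' c \<in> V"
      using b B'(3) C'(3) F'(2) cfun.span_base by blast+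
    have "F' (G' b) = (\<Sum>c\<in>C'. cscale (cfun.representation C' (G' b) c) (F' c))"
      by (rule linear_sum_representation) (use F' C' G' V in auto)
    then have "cfun.representation B' (F' (G' b)) b =
        (\<Sum>c\<in>C'. cfun.representation B' (cscale (cfun.representation C' (G' b) c) (F' c)) b)"
      by (simp only: cfun.representation_sum[OF B'(2)] B'(3)
          cfun.span_scale[of "F' _" B', unfolded B'(3)] V(2))
    also have "\<dots> = (\<Sum>c\<in>C'. cfun.representation C' (G' b) c * cfun.representation B' (F' c) b)"
      using V B' by (intro sum.cong refl) (simp add: cfun.representation_scale)
    finally show ?thesis .
  qed
  have "(\<Sum>b\<in>B. cfun.representation B (F (G b)) b) =
      (\<Sum>b\<in>B. \<Sum>c\<in>C. cfun.representation C (G b) c * cfun.representation B (F c) b)"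
    using assms by (intro sum.cong refl expand)
  also have "\<dots> = (\<Sum>c\<in>C. \<Sum>b\<in>B. cfun.representation B (F c) b * cfun.representation C (G b) c)"
    by (subst sum.swap) (simp add: mult.commute)
  also have "\<dots> = (\<Sum>c\<in>C. cfun.representation C (G (F c)) c)"
    using assms by (intro sum.cong refl expand[symmetric])
  finally show ?thesis .
qed

lemma trace_on_basis:
  assumes "finite B" "cfun.independent B" "cfun.span B = V" "V \<subseteq> supported_on X" "finite X"
    and F: "clinear_op F" "F ` V \<subseteq> V"
  shows "trace_on V F = (\<Sum>b\<in>B. cfun.representation B (F b) b)"
proof -
  define C where "C = (SOME B. B \<subseteq> V \<and> cfun.independent B \<and> cfun.span B = V)"
  have "\<exists>B. B \<subseteq> V \<and> cfun.independent B \<and> cfun.span B = V"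
    using assms(2,3) cfun.span_superset[of B] by (intro exI[of _ B]) simp
  then have C: "C \<subseteq> V \<and> cfun.independent C \<and> cfun.span C = V"
    unfolding C_def by (rule someI_ex)
  then have "finite C"
    using assms(4) by (intro finite_independent_supported_on[OF assms(5)]) auto
  then have "(\<Sum>b\<in>B. cfun.representation B (F (id b)) b) =
      (\<Sum>c\<in>C. cfun.representation C (id (F c)) c)"
    using C by (intro representation_trace_comm[OF F cfun.linear_id _ assms(1-3)]) simp_all
  then show ?thesis
    unfolding trace_on_def C_def[symmetric] by simp
qed

lemma trace_on_comm:
  assumes "cfun.subspace V" "V \<subseteq> supported_on X" "finite X"
    and F: "clinear_op F" "F ` V \<subseteq> V" and G: "clinear_op G" "G ` V \<subseteq> V"
  shows "trace_on V (F \<circ> G) = trace_on V (G \<circ> F)"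
proof -
  obtain B where B: "B \<subseteq> V" "cfun.independent B" "V \<subseteq> cfun.span B"
    using cfun.basis_exists by metis
  then have span: "cfun.span B = V"
    using assms(1) B cfun.span_minimal[of B V] by simp
  have fin: "finite B"
    using assms(2) B by (intro finite_independent_supported_on[OF assms(3)]) auto
  have "clinear_op (F \<circ> G)" "clinear_op (G \<circ> F)"
    using F G by (auto intro: Vector_Spaces.linear_compose)
  moreover have "(F \<circ> G) ` V \<subseteq> V" "(G \<circ> F) ` V \<subseteq> V"
    using F G by auto
  ultimately show ?thesis
    using trace_on_basis[OF fin B(2) span assms(2,3)]
      representation_trace_comm[OF F G fin B(2) span fin B(2) span]
    by simp
qed

section \<open>Orthogonal bases and positivity of traces\<close>

definition cinner :: "'b set \<Rightarrow> ('b \<Rightarrow> complex) \<Rightarrow> ('b \<Rightarrow> complex) \<Rightarrow> complex" where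
  "cinner X f g = (\<Sum>x\<in>X. f x * cnj (g x))"

lemma cinner_add_left: "cinner X (f + g) h = cinner X f h + cinner X g h"
  by (simp add: cinner_def algebra_simps sum.distrib)

lemma cinner_diff_left: "cinner X (f - g) h = cinner X f h - cinner X g h"
  by (simp add: cinner_def algebra_simps sum_subtractf)

lemma cinner_scale_left: "cinner X (cscale c f) h = c * cinner X f h"
  by (simp add: cinner_def cscale_def algebra_simps sum_distrib_left)

lemma cinner_zero_left: "cinner X 0 h = 0"
  by (simp add: cinner_def)

lemma cinner_sum_left: "cinner X (\<Sum>i\<in>I. f i) h = (\<Sum>i\<in>I. cinner X (f i) h)"
  by (induction I rule: infinite_finite_induct)
    (simp_all only: sum.infinite sum.empty sum.insert cinner_add_left cinner_zero_left simp_thms)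

lemma cinner_commute: "cinner X g f = cnj (cinner X f g)"
  by (simp add: cinner_def mult.commute)

lemma cinner_sum_right: "cinner X h (\<Sum>i\<in>I. f i) = (\<Sum>i\<in>I. cinner X h (f i))"
  by (subst cinner_commute) (simp add: cinner_sum_left cinner_commute[of X "f _" h])

lemma cinner_self: "cinner X f f = complex_of_real (\<Sum>x\<in>X. (norm (f x))\<^sup>2)"
  unfolding cinner_def of_real_sum of_real_power
  by (intro sum.cong refl) (simp add: complex_norm_square flip: of_real_power)

lemma cinner_self_eq_0:
  assumes "finite X" "f \<in> supported_on X" "cinner X f f = 0"
  shows "f = 0"
proof -
  have "(\<Sum>x\<in>X. (norm (f x))\<^sup>2) = 0"
    using assms(3) unfolding cinner_self of_real_eq_0_iff .
  then have "\<forall>x\<in>X. f x = 0"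
    using assms(1) by (simp add: sum_nonneg_eq_0_iff)
  then show ?thesis
    using assms(2) by (auto simp: supported_on_def fun_eq_iff)
qed

definition orthogonal_set :: "'b set \<Rightarrow> ('b \<Rightarrow> complex) set \<Rightarrow> bool" where
  "orthogonal_set X B \<longleftrightarrow>
     (\<forall>b\<in>B. cinner X b b \<noteq> 0 \<and> (\<forall>c\<in>B. c \<noteq> b \<longrightarrow> cinner X c b = 0))"

lemma cinner_orthogonal_combination:
  assumes "finite B" "orthogonal_set X B" "b \<in> B"
  shows "cinner X (\<Sum>c\<in>B. cscale (u c) c) b = u b * cinner X b b"
proof -
  have "cinner X (\<Sum>c\<in>B. cscale (u c) c) b = (\<Sum>c\<in>B. if c = b then u b * cinner X b b else 0)"
    unfolding cinner_sum_left cinner_scale_left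
    using assms by (intro sum.cong refl) (auto simp: orthogonal_set_def)
  then show ?thesis
    using assms by simp
qed

lemma orthogonal_independent:
  assumes "finite B" "orthogonal_set X B"
  shows "cfun.independent B"
proof (rule cfun.independent_if_scalars_zero)
  fix u b assume "(\<Sum>c\<in>B. cscale (u c) c) = 0" "b \<in> B"
  then show "u b = 0"
    using cinner_orthogonal_combination[OF assms, of b u] assms(2)
    by (auto simp: cinner_zero_left orthogonal_set_def)
qed fact

lemma orthogonal_representation:
  assumes "finite B" "orthogonal_set X B" "v \<in> cfun.span B" "b \<in> B"
  shows "cfun.representation B v b = cinner X v b / cinner X b b"
proof -
  have "v = (\<Sum>c\<in>B. cscale (cfun.representation B v c) c)"
    using cfun.sum_representation_eq[OF orthogonal_independent[OF assms(1,2)] assms(3,1)] by simp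
  then have "cinner X v b = cfun.representation B v b * cinner X b b"
    using cinner_orthogonal_combination[OF assms(1,2,4)] by metis
  then show ?thesis
    using assms(2,4) by (auto simp: orthogonal_set_def)
qed

lemma subspace_supported_on: "cfun.subspace (supported_on X)"
  by (auto simp: cfun.subspace_def supported_on_def cscale_def)

text \<open>One step of Gram-Schmidt per element of the spanning set.\<close>

lemma orthogonal_basis_finite_set:
  assumes "finite S" "S \<subseteq> supported_on X" "finite X"
  shows "\<exists>B. finite B \<and> orthogonal_set X B \<and> cfun.span B = cfun.span S"
  using assms(1,2)
proof (induction S rule: finite_induct)
  case empty
  then show ?case
    by (intro exI[of _ "{}"]) (auto simp: orthogonal_set_def)
next
  case (insert a S)
  then obtain B where B: "finite B" "orthogonal_set X B" "cfun.span B = cfun.span S"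
    by auto
  define p where "p = (\<Sum>b\<in>B. cscale (cinner X a b / cinner X b b) b)"
  have p: "p \<in> cfun.span B"
    unfolding p_def by (intro cfun.span_sum cfun.span_scale cfun.span_base)
  \<comment> \<open>\<open>p\<close> is the orthogonal projection of \<open>a\<close> to the span of \<open>B\<close>.\<close>
  have orth: "cinner X (a - p) b = 0" if "b \<in> B" for b
    using that cinner_orthogonal_combination[OF B(1,2) that] B(2)
    by (auto simp: cinner_diff_left p_def orthogonal_set_def)
  have "cfun.span (insert a S) = cfun.span (insert a B)"
    using B(3) by (simp add: cfun.span_insert)
  also have "\<dots> = cfun.span (insert (a - p) B)"
    using p by (intro cfun.eq_span_insert_eq) simp
  finally have span: "cfun.span (insert a S) = cfun.span (insert (a - p) B)" .
  show ?case
  proof (cases "a - p = 0")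
    case True
    then show ?thesis
      using B span by (intro exI[of _ B]) (simp add: cfun.span_insert_0)
  next
    case False
    have "cfun.span B \<subseteq> supported_on X"
      using insert.prems B(3) by (simp add: cfun.span_minimal subspace_supported_on)
    then have "a - p \<in> supported_on X"
      using p insert.prems by (intro cfun.subspace_diff subspace_supported_on) auto
    then have "cinner X (a - p) (a - p) \<noteq> 0"
      using False cinner_self_eq_0 \<open>finite X\<close> by blast
    moreover have "cinner X b (a - p) = 0" if "b \<in> B" for b
      using orth[OF that] by (subst cinner_commute) simp
    ultimately show ?thesis
      using B orth span by (intro exI[of _ "insert (a - p) B"]) (auto simp: orthogonal_set_def)
  qed
qed

text \<open>In an orthogonal basis the diagonal entry of \<open>F\<close> at \<open>b\<close> is \<open>\<langle>F b, b\<rangle> / \<langle>b, b\<rangle>\<close>. If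
  \<open>F i j\<close> factors as the adjoint of \<open>T i\<close> after \<open>T j\<close>, then summing over \<open>i\<close> and \<open>j\<close> turns each
  diagonal entry into the quotient of the squared norms of \<open>\<Sum>j. T j b\<close> and \<open>b\<close>.\<close>

lemma trace_on_positive_definite:
  assumes V: "cfun.subspace V" "V \<subseteq> supported_on X" "finite X"
    and F: "\<And>i j. i \<in> I \<Longrightarrow> j \<in> I \<Longrightarrow> clinear_op (F i j)"
      "\<And>i j. i \<in> I \<Longrightarrow> j \<in> I \<Longrightarrow> F i j ` V \<subseteq> V"
    and adj: "\<And>i j v. i \<in> I \<Longrightarrow> j \<in> I \<Longrightarrow> v \<in> V \<Longrightarrow> cinner X (F i j v) v = cinner X (T j v) (T i v)"
  shows "\<exists>t\<ge>0. (\<Sum>i\<in>I. \<Sum>j\<in>I. trace_on V (F i j)) = complex_of_real t"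
proof -
  obtain S where S: "S \<subseteq> V" "cfun.independent S" "V \<subseteq> cfun.span S"
    using cfun.basis_exists by metis
  then have "finite S"
    using V(2) by (intro finite_independent_supported_on[OF V(3)]) auto
  then obtain B where B: "finite B" "orthogonal_set X B" "cfun.span B = cfun.span S"
    using orthogonal_basis_finite_set[of S X] S V by blast
  have span: "cfun.span B = V"
    using S V(1) cfun.span_minimal[of S V] B(3) by simp
  have indep: "cfun.independent B"
    using B orthogonal_independent by blast
  define N where "N = (\<lambda>f. \<Sum>x\<in>X. (norm (f x :: complex))\<^sup>2)"
  have N: "N f \<ge> 0" for f
    unfolding N_def by (intro sum_nonneg) auto
  have B_V: "b \<in> V" if "b \<in> B" for b
    using that span cfun.span_base by auto
  have trace: "trace_on V (F i j) = (\<Sum>b\<in>B. cinner X (T j b) (T i b) / of_real (N b))"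
    if "i \<in> I" "j \<in> I" for i j
  proof -
    have "trace_on V (F i j) = (\<Sum>b\<in>B. cfun.representation B (F i j b) b)"
      using B indep span V F that by (intro trace_on_basis) auto
    also have "\<dots> = (\<Sum>b\<in>B. cinner X (T j b) (T i b) / of_real (N b))"
    proof (intro sum.cong refl)
      fix b assume b: "b \<in> B"
      have "cfun.representation B (F i j b) b = cinner X (F i j b) b / cinner X b b"
        using F(2)[OF that] B_V b span B by (intro orthogonal_representation) auto
      then show "cfun.representation B (F i j b) b = cinner X (T j b) (T i b) / of_real (N b)"
        using adj[OF that B_V[OF b]] by (simp add: cinner_self N_def)
    qed
    finally show ?thesis .
  qed
  have "(\<Sum>i\<in>I. \<Sum>j\<in>I. trace_on V (F i j)) =
      (\<Sum>i\<in>I. \<Sum>j\<in>I. \<Sum>b\<in>B. cinner X (T j b) (T i b) / of_real (N b))"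
    by (intro sum.cong refl trace)
  also have "\<dots> = (\<Sum>b\<in>B. \<Sum>i\<in>I. \<Sum>j\<in>I. cinner X (T j b) (T i b) / of_real (N b))"
    by (subst (2) sum.swap, subst sum.swap) simp
  also have "\<dots> = (\<Sum>b\<in>B. cinner X (\<Sum>j\<in>I. T j b) (\<Sum>i\<in>I. T i b) / of_real (N b))"
    by (simp add: cinner_sum_left cinner_sum_right sum_divide_distrib) 
  also have "\<dots> = of_real (\<Sum>b\<in>B. N (\<Sum>j\<in>I. T j b) / N b)"
    by (simp add: cinner_self N_def)
  finally show ?thesis
    using N by (intro exI[of _ "\<Sum>b\<in>B. N (\<Sum>j\<in>I. T j b) / N b"]) (auto intro!: sum_nonneg)
qed

section \<open>Lattice bases and integrality of traces\<close>

definition integer_valued :: "('b \<Rightarrow> complex) set" where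
  "integer_valued = {f. \<forall>x. f x \<in> \<int>}"

text \<open>A basis in echelon form, built by induction on the support. The values at the point \<open>x\<close> of the
  functions in \<open>M\<close> form a subgroup of the integers; an element \<open>v\<close> of \<open>M\<close> whose value at \<open>x\<close>
  generates this subgroup is added to a basis of the functions in \<open>M\<close> that vanish at \<open>x\<close>.\<close>

lemma integer_lattice_basis:
  assumes "finite X" "M \<subseteq> supported_on X" "M \<subseteq> integer_valued"
    and "0 \<in> M" "\<And>f g. f \<in> M \<Longrightarrow> g \<in> M \<Longrightarrow> f - g \<in> M"
  shows "\<exists>B. finite B \<and> B \<subseteq> M \<and> cfun.independent B \<and>
    (\<forall>f\<in>M. \<exists>c :: ('b \<Rightarrow> complex) \<Rightarrow> int. f = (\<Sum>b\<in>B. cscale (of_int (c b)) b))"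
  using assms
proof (induction X arbitrary: M rule: finite_induct)
  case empty
  have "f = 0" if "f \<in> M" for f
    using that empty.prems(1) by (auto simp: supported_on_def fun_eq_iff)
  then have "M = {0}"
    using empty.prems(3) by blast
  then show ?case
    by (intro exI[of _ "{}"]) (auto simp: cfun.independent_empty)
next
  case (insert x X)
  note diff = insert.prems(4)
  define M' where "M' = {f \<in> M. f x = 0}"
  have "\<exists>B. finite B \<and> B \<subseteq> M' \<and> cfun.independent B \<and>
    (\<forall>f\<in>M'. \<exists>c :: ('b \<Rightarrow> complex) \<Rightarrow> int. f = (\<Sum>b\<in>B. cscale (of_int (c b)) b))"
  proof (rule insert.IH)
    show "M' \<subseteq> supported_on X"
    proof
      fix f assume f: "f \<in> M'"
      then have "f \<in> supported_on (insert x X)"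
        using insert.prems(1) by (auto simp: M'_def)
      then show "f \<in> supported_on X"
        using f by (auto simp: M'_def supported_on_def)
    qed
  qed (use insert.prems in \<open>auto simp: M'_def\<close>)
  then obtain B where B: "finite B" "B \<subseteq> M'" "cfun.independent B"
    "\<And>f. f \<in> M' \<Longrightarrow> \<exists>c :: ('b \<Rightarrow> complex) \<Rightarrow> int. f = (\<Sum>b\<in>B. cscale (of_int (c b)) b)"
    by metis
  show ?case
  proof (cases "M' = M")
    case True
    then show ?thesis using B by auto
  next
    case False
    have neg: "- f \<in> M" if "f \<in> M" for f
      using diff[OF insert.prems(3) that] by (simp only: diff_0)
    have mult_nat: "cscale (of_nat k) f \<in> M" if "f \<in> M" for f k
    proof (induction k)
      case 0
      then show ?case using insert.prems(3) by (simp add: cscale_def zero_fun_def)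
    next
      case (Suc k)
      have "cscale (of_nat (Suc k)) f = cscale (of_nat k) f - (- f)"
        by (simp add: cscale_def fun_eq_iff algebra_simps)
      then show ?case using diff[OF Suc neg[OF that]] by (simp only:)
    qed
    have mult_int: "cscale (of_int k) f \<in> M" if "f \<in> M" for f k
    proof (cases k)
      case (nonneg m)
      then show ?thesis using mult_nat[OF that, of m] by simp
    next
      case (neg m)
      have "cscale (of_int k) f = - cscale (of_nat (Suc m)) f"
        unfolding neg by (simp add: cscale_def fun_eq_iff algebra_simps)
      then show ?thesis using \<open>\<And>f. f \<in> M \<Longrightarrow> - f \<in> M\<close> mult_nat[OF that] by metis
    qed
    \<comment> \<open>The least positive value at \<open>x\<close> divides all values at \<open>x\<close>, by division with remainder.\<close>
    define D where "D = {d :: nat. d > 0 \<and> (\<exists>f\<in>M. f x = of_nat d)}"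
    define d where "d = (LEAST d. d \<in> D)"
    have "\<exists>d. d \<in> D"
    proof -
      obtain f where f: "f \<in> M" "f x \<noteq> 0"
        using False by (auto simp: M'_def)
      then obtain k :: int where k: "f x = of_int k"
        using insert.prems(2) by (auto simp: integer_valued_def Ints_def)
      show ?thesis
      proof (cases "k > 0")
        case True
        then have "nat k \<in> D" using f k by (auto simp: D_def)
        then show ?thesis ..
      next
        case False
        then have "nat (- k) \<in> D"
          using f k neg[OF f(1)] by (auto simp: D_def intro!: bexI[of _ "- f"])
        then show ?thesis ..
      qed
    qed
    then have "d \<in> D"
      unfolding d_def by (rule LeastI_ex)
    then obtain v where v: "v \<in> M" "v x = of_nat d" and d: "d > 0"
      by (auto simp: D_def)
    have reduce: "\<exists>k :: int. f - cscale (of_int k) v \<in> M'" if f: "f \<in> M" for f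
    proof -
      obtain m :: int where m: "f x = of_int m"
        using insert.prems(2) f by (auto simp: integer_valued_def Ints_def)
      define g where "g = f - cscale (of_int (m div int d)) v"
      have g: "g \<in> M"
        unfolding g_def by (intro diff f mult_int v)
      have "g x = of_int (m - m div int d * int d)"
        by (simp add: g_def m v cscale_def)
      also have "m - m div int d * int d = m mod int d"
        by (simp add: minus_div_mult_eq_mod)
      finally have gx: "g x = of_nat (nat (m mod int d))"
        using d by simp
      have "nat (m mod int d) < d"
        using d by (simp add: nat_less_iff)
      then have "nat (m mod int d) \<notin> D"
        unfolding d_def by (rule not_less_Least)
      then have "nat (m mod int d) = 0"
        using g gx unfolding D_def neq0_conv[symmetric] by blast
      then have "g \<in> M'"
        using g gx by (simp add: M'_def)
      then show ?thesis by (auto simp: g_def)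
    qed
    have "cfun.subspace {f :: 'b \<Rightarrow> complex. f x = 0}"
      by (auto simp: cfun.subspace_def cscale_def)
    then have "cfun.span B \<subseteq> {f. f x = 0}"
      using B(2) by (intro cfun.span_minimal) (auto simp: M'_def)
    then have vB: "v \<notin> cfun.span B"
      using v d by auto
    then have "v \<notin> B"
      using cfun.span_base by blast
    have "\<exists>c :: ('b \<Rightarrow> complex) \<Rightarrow> int. f = (\<Sum>b\<in>insert v B. cscale (of_int (c b)) b)"
      if f: "f \<in> M" for f
    proof -
      obtain k :: int where k: "f - cscale (of_int k) v \<in> M'"
        using reduce[OF f] by blast
      then obtain c :: "('b \<Rightarrow> complex) \<Rightarrow> int"
        where c: "f - cscale (of_int k) v = (\<Sum>b\<in>B. cscale (of_int (c b)) b)"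
        using B(4) by blast
      have "f = cscale (of_int k) v + (\<Sum>b\<in>B. cscale (of_int (c b)) b)"
        using c by (simp add: algebra_simps)
      also have "(\<Sum>b\<in>B. cscale (of_int (c b)) b) =
          (\<Sum>b\<in>B. cscale (of_int ((c(v := k)) b)) b)"
        using \<open>v \<notin> B\<close> by (intro sum.cong) auto
      finally have "f = (\<Sum>b\<in>insert v B. cscale (of_int ((c(v := k)) b)) b)"
        using B(1) \<open>v \<notin> B\<close> by (simp only: sum.insert fun_upd_same simp_thms)
      then show ?thesis by blast
    qed
    moreover have "cfun.independent (insert v B)"
      using vB B(3) by (rule cfun.independent_insertI)
    ultimately show ?thesis
      using B v by (intro exI[of _ "insert v B"]) (auto simp: M'_def)
  qed
qed

text \<open>The integer-valued functions in the span form a lattice that \<open>F\<close> maps into itself. It contains the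
  spanning set \<open>S\<close>, so a lattice basis of it is also a basis of the span, and with
  respect to this basis the matrix of \<open>F\<close> is integral.\<close>

lemma trace_on_in_Ints:
  assumes S: "S \<subseteq> supported_on X" "S \<subseteq> integer_valued" "finite X"
    and F: "clinear_op F" "F ` cfun.span S \<subseteq> cfun.span S" "F ` integer_valued \<subseteq> integer_valued"
  shows "trace_on (cfun.span S) F \<in> \<int>"
proof -
  define V where "V = cfun.span S"
  have V: "cfun.subspace V" "V \<subseteq> supported_on X" "S \<subseteq> V"
    unfolding V_def
    by (rule cfun.subspace_span cfun.span_minimal[OF S(1) subspace_supported_on]
        cfun.span_superset)+
  define M where "M = V \<inter> integer_valued"
  have "\<exists>B. finite B \<and> B \<subseteq> M \<and> cfun.independent B \<and>
    (\<forall>f\<in>M. \<exists>c :: ('a \<Rightarrow> complex) \<Rightarrow> int. f = (\<Sum>b\<in>B. cscale (of_int (c b)) b))"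
    using V S(3) by (intro integer_lattice_basis[of X])
      (auto simp: M_def integer_valued_def cfun.subspace_0 cfun.subspace_diff)
  then obtain B where B: "finite B" "B \<subseteq> M" "cfun.independent B"
    and c: "\<And>f. f \<in> M \<Longrightarrow> \<exists>c :: ('a \<Rightarrow> complex) \<Rightarrow> int. f = (\<Sum>b\<in>B. cscale (of_int (c b)) b)"
    by metis
  have "M \<subseteq> cfun.span B"
  proof
    fix f assume "f \<in> M"
    then obtain c :: "('a \<Rightarrow> complex) \<Rightarrow> int" where "f = (\<Sum>b\<in>B. cscale (of_int (c b)) b)"
      using c by blast
    then show "f \<in> cfun.span B"
      by (simp add: cfun.span_sum cfun.span_scale cfun.span_base)
  qed
  moreover have "S \<subseteq> M"
    using V S by (auto simp: M_def)
  ultimately have "V \<subseteq> cfun.span B"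
    unfolding V_def by (intro cfun.span_minimal) auto
  moreover have "cfun.span B \<subseteq> V"
    using B V by (intro cfun.span_minimal) (auto simp: M_def)
  ultimately have span: "cfun.span B = V" by blast
  have "cfun.representation B (F b) b \<in> \<int>" if b: "b \<in> B" for b
  proof -
    have "F b \<in> M"
      using b B(2) F(2,3) unfolding M_def V_def by blast
    then obtain c :: "('a \<Rightarrow> complex) \<Rightarrow> int" where "F b = (\<Sum>b\<in>B. cscale (of_int (c b)) b)"
      using c by blast
    then have "cfun.representation B (F b) b = (\<Sum>a\<in>B. of_int (c a) * cfun.representation B a b)"
      using B(3) by (simp add: cfun.representation_sum cfun.representation_scale
          cfun.span_scale cfun.span_base)
    also have "\<dots> \<in> \<int>"
      using B(3) by (intro Ints_sum Ints_mult) (auto simp: cfun.representation_basis)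
    finally show ?thesis .
  qed
  moreover have "trace_on V F = (\<Sum>b\<in>B. cfun.representation B (F b) b)"
    using B span V S F by (intro trace_on_basis) (auto simp: V_def)
  ultimately show ?thesis
    unfolding V_def[symmetric] by auto
qed

section \<open>Specht modules and their characters\<close>

text \<open>A finite set that contains all tabloids and is stable under the symmetric group; it serves as the
  common support of all polytabloids.\<close>

definition row_fillings :: "nat \<Rightarrow> nat multiset \<Rightarrow> nat set list set" where
  "row_fillings n lam = {T. set T \<subseteq> Pow {1..n} \<and> length T = length (rows lam)}"

lemma finite_row_fillings: "finite (row_fillings n lam)"
  unfolding row_fillings_def by (intro finite_lists_length_eq) simp

lemma tabloid_in_row_fillings:
  assumes "t \<in> tableaux n lam"
  shows "tabloid lam t \<in> row_fillings n lam"
proof -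
  have "t (i, j) \<in> {1..n}" if "i < length (rows lam)" "j < rows lam ! i" for i j
    using that assms by (auto simp: tableaux_def cells_def dest!: bij_betwE)
  then show ?thesis
    unfolding row_fillings_def tabloid_def by auto
qed

lemma permutes_comp_tableau:
  assumes "\<sigma> permutes {1..n}" "t \<in> tableaux n lam"
  shows "\<sigma> \<circ> t \<in> tableaux n lam"
  using assms permutes_imp_bij unfolding tableaux_def by (auto intro: bij_betw_trans)

lemma tabloid_comp: "tabloid lam (\<sigma> \<circ> t) = map ((`) \<sigma>) (tabloid lam t)"
  by (simp add: tabloid_def image_image comp_def)

lemma linear_perm_act: "clinear_op (perm_act \<sigma>)"
  by (simp add: Vector_Spaces.linear_iff cfun.vector_space_axioms perm_act_def cscale_def fun_eq_iff)

lemma perm_act_comp: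
  assumes "\<sigma> permutes S" "\<tau> permutes S"
  shows "perm_act (\<sigma> \<circ> \<tau>) = perm_act \<sigma> \<circ> perm_act \<tau>"
proof -
  have "inv (\<sigma> \<circ> \<tau>) = inv \<tau> \<circ> inv \<sigma>"
    using assms by (intro o_inv_distrib permutes_bij)
  then have "map ((`) (inv (\<sigma> \<circ> \<tau>))) T = map ((`) (inv \<tau>)) (map ((`) (inv \<sigma>)) T)" for T
    by (simp add: image_image comp_def)
  then show ?thesis
    by (simp add: perm_act_def fun_eq_iff del: map_map)
qed

lemma map_image_permutes_inverses:
  assumes "\<sigma> permutes S"
  shows "map ((`) \<sigma>) (map ((`) (inv \<sigma>)) T) = T" "map ((`) (inv \<sigma>)) (map ((`) \<sigma>) T) = T"
  using assms by (simp_all add: comp_def permutes_inverses image_image)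

lemma map_image_inv_eq_iff:
  assumes "\<sigma> permutes S"
  shows "T = map ((`) (inv \<sigma>)) U \<longleftrightarrow> map ((`) \<sigma>) T = U"
  using map_image_permutes_inverses[OF assms] by metis

lemma column_stabilizer_conjugate:
  assumes \<sigma>: "\<sigma> permutes {1..n}" and \<pi>: "\<pi> \<in> column_stabilizer n lam t"
  shows "\<sigma> \<circ> \<pi> \<circ> inv \<sigma> \<in> column_stabilizer n lam (\<sigma> \<circ> t)"
proof -
  have "\<sigma> \<circ> \<pi> \<circ> inv \<sigma> permutes {1..n}"
    using assms by (intro permutes_compose permutes_inv) (auto simp: column_stabilizer_def)
  then show ?thesis
    using \<pi> permutes_inverses[OF \<sigma>] unfolding column_stabilizer_def by fastforce
qed

text \<open>Conjugation by \<open>\<sigma>\<close> carries the column stabilizer of \<open>t\<close> to that of \<open>\<sigma> \<circ> t\<close> and preserves signs.\<close>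

lemma perm_act_polytabloid:
  assumes \<sigma>: "\<sigma> permutes {1..n}"
  shows "perm_act \<sigma> (polytabloid n lam t) = polytabloid n lam (\<sigma> \<circ> t)"
proof
  fix T
  note inv = permutes_inverses[OF \<sigma>]
  have o_inv: "inv \<sigma> \<circ> (\<sigma> \<circ> h) = h" "\<sigma> \<circ> (inv \<sigma> \<circ> h) = h"
      "(h' \<circ> inv \<sigma>) \<circ> \<sigma> = h'" "(h' \<circ> \<sigma>) \<circ> inv \<sigma> = h'" for h :: "nat \<times> nat \<Rightarrow> nat" and h' :: "nat \<Rightarrow> nat"
    by (simp_all add: fun_eq_iff inv)
  have sign: "sign (\<sigma> \<circ> \<pi> \<circ> inv \<sigma>) = sign \<pi>" if "\<pi> \<in> column_stabilizer n lam t" for \<pi>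
  proof -
    have "permutation \<pi>" "permutation \<sigma>"
      using that \<sigma> by (auto simp: column_stabilizer_def intro: permutation_permutes[THEN iffD2])
    then show ?thesis
      by (simp add: sign_compose permutation_compose permutation_inverse sign_inverse)
  qed
  have "polytabloid n lam (\<sigma> \<circ> t) T = (\<Sum>\<pi>\<in>column_stabilizer n lam t.
        of_int (sign \<pi>) * (if tabloid lam (\<sigma> \<circ> (\<pi> \<circ> t)) = T then 1 else 0))"
    unfolding polytabloid_def
  proof (rule sum.reindex_bij_witness[of _ "\<lambda>\<pi>. \<sigma> \<circ> \<pi> \<circ> inv \<sigma>" "\<lambda>\<pi>. inv \<sigma> \<circ> \<pi> \<circ> \<sigma>"])
    fix \<pi> assume \<pi>: "\<pi> \<in> column_stabilizer n lam (\<sigma> \<circ> t)"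
    show "inv \<sigma> \<circ> \<pi> \<circ> \<sigma> \<in> column_stabilizer n lam t"
      using column_stabilizer_conjugate[OF permutes_inv[OF \<sigma>] \<pi>]
      by (simp add: o_inv permutes_inv_inv[OF \<sigma>])
    then have "sign (\<sigma> \<circ> (inv \<sigma> \<circ> \<pi> \<circ> \<sigma>) \<circ> inv \<sigma>) = sign (inv \<sigma> \<circ> \<pi> \<circ> \<sigma>)"
      by (rule sign)
    moreover have "\<sigma> \<circ> (inv \<sigma> \<circ> \<pi> \<circ> \<sigma>) \<circ> inv \<sigma> = \<pi>"
      by (simp add: fun_eq_iff inv)
    moreover have "\<sigma> \<circ> (inv \<sigma> \<circ> \<pi> \<circ> \<sigma> \<circ> t) = \<pi> \<circ> (\<sigma> \<circ> t)"
      by (simp add: fun_eq_iff inv)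
    ultimately show "of_int (sign (inv \<sigma> \<circ> \<pi> \<circ> \<sigma>)) *
        (if tabloid lam (\<sigma> \<circ> (inv \<sigma> \<circ> \<pi> \<circ> \<sigma> \<circ> t)) = T then 1 else 0) =
      (of_int (sign \<pi>) * (if tabloid lam (\<pi> \<circ> (\<sigma> \<circ> t)) = T then 1 else 0) :: complex)"
      by simp
  qed (use column_stabilizer_conjugate[OF \<sigma>] in \<open>auto simp: fun_eq_iff inv\<close>)
  also have "\<dots> = polytabloid n lam t (map ((`) (inv \<sigma>)) T)"
    unfolding polytabloid_def map_image_inv_eq_iff[OF \<sigma>] tabloid_comp[of lam \<sigma>] ..
  finally show "perm_act \<sigma> (polytabloid n lam t) T = polytabloid n lam (\<sigma> \<circ> t) T"
    by (simp add: perm_act_def)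
qed

lemma perm_act_specht:
  assumes "\<sigma> permutes {1..n}"
  shows "perm_act \<sigma> ` specht n lam \<subseteq> specht n lam"
proof -
  interpret \<sigma>: Vector_Spaces.linear cscale cscale "perm_act \<sigma> :: (nat set list \<Rightarrow> complex) \<Rightarrow> _"
    by (rule linear_perm_act)
  have "perm_act \<sigma> ` polytabloid n lam ` tableaux n lam \<subseteq> polytabloid n lam ` tableaux n lam"
    using assms by (auto simp: perm_act_polytabloid intro!: imageI permutes_comp_tableau)
  then show ?thesis
    unfolding specht_def \<sigma>.span_image[symmetric] by (rule cfun.span_mono)
qed

lemma polytabloid_supported_on:
  assumes "t \<in> tableaux n lam"
  shows "polytabloid n lam t \<in> supported_on (row_fillings n lam)"
proof -
  have "polytabloid n lam t T = 0" if "T \<notin> row_fillings n lam" for T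
    unfolding polytabloid_def
  proof (intro sum.neutral ballI)
    fix \<pi> assume "\<pi> \<in> column_stabilizer n lam t"
    then have "tabloid lam (\<pi> \<circ> t) \<in> row_fillings n lam"
      using assms
      by (intro tabloid_in_row_fillings permutes_comp_tableau) (auto simp: column_stabilizer_def)
    then show "of_int (sign \<pi>) * (if tabloid lam (\<pi> \<circ> t) = T then 1 else (0 :: complex)) = 0"
      using that by auto
  qed
  then show ?thesis
    by (simp add: supported_on_def)
qed

lemma polytabloid_integer_valued: "polytabloid n lam t \<in> integer_valued"
  unfolding integer_valued_def polytabloid_def by (auto intro!: Ints_sum Ints_mult)

lemma specht_subspace: "cfun.subspace (specht n lam)"
  unfolding specht_def by (rule cfun.subspace_span)

lemma specht_supported_on: "specht n lam \<subseteq> supported_on (row_fillings n lam)"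
  unfolding specht_def
  by (intro cfun.span_minimal subspace_supported_on image_subsetI polytabloid_supported_on)

lemma irr_char_comm:
  assumes "\<sigma> permutes {1..n}" "\<tau> permutes {1..n}"
  shows "irr_char n lam (\<sigma> \<circ> \<tau>) = irr_char n lam (\<tau> \<circ> \<sigma>)"
  unfolding irr_char_def perm_act_comp[OF assms] perm_act_comp[OF assms(2,1)]
  using assms
  by (intro trace_on_comm[OF specht_subspace specht_supported_on finite_row_fillings]
      linear_perm_act perm_act_specht)

lemma irr_char_in_Ints:
  assumes "\<sigma> permutes {1..n}"
  shows "irr_char n lam \<sigma> \<in> \<int>"
  unfolding irr_char_def specht_def
proof (rule trace_on_in_Ints[OF _ _ finite_row_fillings linear_perm_act])
  show "perm_act \<sigma> ` cfun.span (polytabloid n lam ` tableaux n lam)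
      \<subseteq> cfun.span (polytabloid n lam ` tableaux n lam)"
    using perm_act_specht[OF assms] unfolding specht_def .
  show "polytabloid n lam ` tableaux n lam \<subseteq> supported_on (row_fillings n lam)"
    by (intro image_subsetI polytabloid_supported_on)
  show "polytabloid n lam ` tableaux n lam \<subseteq> integer_valued"
    by (intro image_subsetI polytabloid_integer_valued)
qed (auto simp: integer_valued_def perm_act_def)

text \<open>The symmetric group permutes the tabloids and hence acts by unitary operators.\<close>

lemma cinner_perm_act:
  assumes "\<sigma> permutes {1..n}"
  shows "cinner (row_fillings n lam) (perm_act \<sigma> f) g =
    cinner (row_fillings n lam) f (perm_act (inv \<sigma>) g)"
proof -
  have *: "map ((`) \<tau>) T \<in> row_fillings n lam"
    if "\<tau> permutes {1..n}" "T \<in> row_fillings n lam" for \<tau> T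
  proof -
    have "\<tau> ` A \<subseteq> {1..n}" if "A \<in> set T" for A
      using that \<open>T \<in> _\<close> permutes_image[OF \<open>\<tau> permutes _\<close>] unfolding row_fillings_def by blast
    then show ?thesis
      using that by (auto simp: row_fillings_def)
  qed
  show ?thesis
    unfolding cinner_def perm_act_def permutes_inv_inv[OF assms]
    by (rule sum.reindex_bij_witness[of _ "map ((`) \<sigma>)" "map ((`) (inv \<sigma>))"])
      (use * assms permutes_inv[OF assms] in
        \<open>simp_all add: map_image_permutes_inverses[OF assms] del: map_map\<close>)
qed

text \<open>Characters are positive definite functions, because \<open>g h\<inverse>\<close> acts as the adjoint of
  \<open>g\<inverse>\<close> composed with \<open>h\<inverse>\<close>.\<close>

lemma irr_char_positive_definite:
  assumes g: "\<And>i. i \<in> I \<Longrightarrow> g i permutes {1..n}"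
  shows "\<exists>t\<ge>0. (\<Sum>i\<in>I. \<Sum>j\<in>I. irr_char n lam (g i \<circ> inv (g j))) = complex_of_real t"
  unfolding irr_char_def
proof (rule trace_on_positive_definite[OF specht_subspace specht_supported_on finite_row_fillings
      linear_perm_act, where T = "\<lambda>j. perm_act (inv (g j))"])
  fix i j assume ij: "i \<in> I" "j \<in> I"
  note perm = g[OF ij(1)] permutes_inv[OF g[OF ij(2)]]
  show "perm_act (g i \<circ> inv (g j)) ` specht n lam \<subseteq> specht n lam"
    using perm by (intro perm_act_specht permutes_compose)
  show "cinner (row_fillings n lam) (perm_act (g i \<circ> inv (g j)) v) v =
      cinner (row_fillings n lam) (perm_act (inv (g j)) v) (perm_act (inv (g i)) v)" for v
    using perm by (simp add: perm_act_comp[OF perm] cinner_perm_act)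
qed

section \<open>Conjugacy of permutations of equal cycle type\<close>

lemma cyclic_on_power_bij:
  assumes "cyclic_on f C" "x \<in> C"
  shows "bij_betw (\<lambda>i. (f ^^ i) x) {..<card C} C" "(f ^^ card C) x = x"
proof -
  have x: "x \<in> orbit f x" "C = orbit f x"
    using assms by (auto simp: cyclic_on_alldef)
  define k where "k = funpow_dist1 f x x"
  have "bij_betw (\<lambda>i. (f ^^ i) x) {..<k} C"
    using inj_on_funpow_dist1[OF x(1)] orbit_conv_funpow_dist1[OF x(1)] x(2)
    unfolding k_def bij_betw_def lessThan_atLeast0 by simp
  moreover from this have "card C = k"
    using bij_betw_same_card by fastforce
  moreover have "(f ^^ k) x = x"
    using funpow_dist1_prop[OF x(1)] unfolding k_def .
  ultimately show "bij_betw (\<lambda>i. (f ^^ i) x) {..<card C} C" "(f ^^ card C) x = x"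
    by simp_all
qed

lemma cyclic_on_conjugate:
  assumes C: "cyclic_on f C" and D: "cyclic_on g D" and card: "card C = card D"
  shows "\<exists>h. h ` C = D \<and> (\<forall>x\<in>C. h (f x) = g (h x))"
proof -
  obtain x y where x: "x \<in> C" and y: "y \<in> D"
    using C D unfolding cyclic_on_def by blast
  define k where "k = card C"
  note f = cyclic_on_power_bij[OF C x, folded k_def]
  note g = cyclic_on_power_bij[OF D y, folded card k_def]
  define p where "p = inv_into {..<k} (\<lambda>i. (f ^^ i) x)"
  define h where "h = (\<lambda>z. (g ^^ p z) y)"
  have p: "p ((f ^^ i) x) = i" if "i < k" for i
    unfolding p_def using f(1) that by (intro inv_into_f_f) (auto simp: bij_betw_def)
  have h: "h ((f ^^ i) x) = (g ^^ i) y" if "i < k" for i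
    unfolding h_def using p that by simp
  \<comment> \<open>\<open>h\<close> transports the numbering of \<open>C\<close> by powers of \<open>f\<close> at \<open>x\<close> to that of \<open>D\<close> by powers of \<open>g\<close> at \<open>y\<close>.\<close>
  have Cf: "C = (\<lambda>i. (f ^^ i) x) ` {..<k}" and Dg: "D = (\<lambda>i. (g ^^ i) y) ` {..<k}"
    using f(1) g(1) by (auto simp: bij_betw_def)
  have "h (f z) = g (h z)" if "z \<in> C" for z
  proof -
    obtain i where i: "i < k" "z = (f ^^ i) x"
      using \<open>z \<in> C\<close> Cf by auto
    have Suc: "h ((f ^^ Suc i) x) = (g ^^ Suc i) y"
    proof (cases "Suc i < k")
      case False
      then have "Suc i = k" using i by simp
      then show ?thesis using f(2) g(2) h[of 0] i by simp
    qed (rule h)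
    then show ?thesis using h i by simp
  qed
  moreover have "h ` C = D"
    unfolding Cf Dg using h by (auto simp: image_image)
  ultimately show ?thesis by blast
qed

lemma image_mset_eq_imp_bij:
  assumes "finite A" "finite B" "image_mset f (mset_set A) = image_mset g (mset_set B)"
  shows "\<exists>h. bij_betw h A B \<and> (\<forall>a\<in>A. g (h a) = f a)"
  using assms
proof (induction A arbitrary: B rule: finite_induct)
  case empty
  then show ?case by (auto simp: bij_betw_def mset_set_empty_iff)
next
  case (insert a A)
  have "f a \<in># image_mset g (mset_set B)"
    using insert by (simp flip: insert.prems(2))
  then obtain b where b: "b \<in> B" "g b = f a"
    using insert.prems(1) by auto
  have "mset_set B = add_mset b (mset_set (B - {b}))"
    using b insert.prems(1) by (metis finite_Diff insert_Diff mset_set.insert_remove insert_Diff_single Diff_idemp)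
  then have "image_mset f (mset_set A) = image_mset g (mset_set (B - {b}))"
    using insert b by simp
  then obtain h where h: "bij_betw h A (B - {b})" "\<forall>a\<in>A. g (h a) = f a"
    using insert.IH[of "B - {b}"] insert.prems(1) by auto
  define h' where "h' = h(a := b)"
  have "bij_betw h' (insert a A) (insert b (B - {b}))"
    using h(1) insert.hyps(2) unfolding h'_def
    by (intro bij_betw_combine[of _ "{a}" "{b}" A, simplified])
      (auto simp: bij_betw_def inj_on_def)
  moreover have "insert b (B - {b}) = B" using b by auto
  moreover have "\<forall>c\<in>insert a A. g (h' c) = f c"
    using h(2) b(2) insert.hyps(2) by (auto simp: h'_def)
  ultimately show ?case by metis
qed

text \<open>Pair up the cycles of \<open>\<sigma>\<close> and \<open>\<tau>\<close> so that the lengths agree, conjugate each cycle of \<open>\<sigma>\<close> to its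
  partner, and glue these conjugations together.\<close>

lemma same_cycle_type_imp_conjugate:
  assumes \<sigma>: "\<sigma> permutes {1..n}" and \<tau>: "\<tau> permutes {1..n}"
    and type: "cycle_type n \<sigma> = cycle_type n \<tau>"
  shows "\<exists>\<rho>. \<rho> permutes {1..n} \<and> \<rho> \<circ> \<sigma> = \<tau> \<circ> \<rho>"
proof -
  have cyc: "cyclic_on \<sigma> (orbit \<sigma> x)" "cyclic_on \<tau> (orbit \<tau> x)" for x
    using \<sigma> \<tau> by (auto intro: cyclic_on_orbit)
  have self: "x \<in> orbit \<sigma> x" "x \<in> orbit \<tau> x" for x
    using \<sigma> \<tau> by (auto intro!: permutation_self_in_orbit permutation_permutes[THEN iffD2])
  obtain h where h: "bij_betw h (orbit \<sigma> ` {1..n}) (orbit \<tau> ` {1..n})"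
    and card: "\<And>x. x \<in> {1..n} \<Longrightarrow> card (h (orbit \<sigma> x)) = card (orbit \<sigma> x)"
    using image_mset_eq_imp_bij[OF _ _ type[unfolded cycle_type_def]] by auto
  have "\<exists>q. q ` orbit \<sigma> x = h (orbit \<sigma> x) \<and> (\<forall>z\<in>orbit \<sigma> x. q (\<sigma> z) = \<tau> (q z))"
    if x: "x \<in> {1..n}" for x
  proof -
    have "h (orbit \<sigma> x) \<in> orbit \<tau> ` {1..n}"
      using bij_betw_apply[OF h imageI[OF x]] .
    then show ?thesis
      using cyc card[OF x] by (intro cyclic_on_conjugate) auto
  qed
  then have "\<forall>C\<in>orbit \<sigma> ` {1..n}. \<exists>q. q ` C = h C \<and> (\<forall>z\<in>C. q (\<sigma> z) = \<tau> (q z))"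
    by auto
  then obtain q where q: "\<And>C. C \<in> orbit \<sigma> ` {1..n} \<Longrightarrow> q C ` C = h C"
    "\<And>C z. C \<in> orbit \<sigma> ` {1..n} \<Longrightarrow> z \<in> C \<Longrightarrow> q C (\<sigma> z) = \<tau> (q C z)"
    by metis
  define \<rho> where "\<rho> = (\<lambda>x. if x \<in> {1..n} then q (orbit \<sigma> x) x else x)"
  have step: "orbit \<sigma> (\<sigma> x) = orbit \<sigma> x" for x
    using \<sigma> by (auto intro!: permutation_orbit_step permutation_permutes[THEN iffD2])
  have "\<rho> (\<sigma> x) = \<tau> (\<rho> x)" for x
  proof (cases "x \<in> {1..n}")
    case True
    then show ?thesis
      using q(2)[of "orbit \<sigma> x" x] self(1)[of x] permutes_in_image[OF \<sigma>]
      by (simp add: \<rho>_def step)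
  next
    case False
    then show ?thesis
      using permutes_not_in[OF \<sigma> False] permutes_not_in[OF \<tau> False] False
      by (auto simp: \<rho>_def)
  qed
  then have comm: "\<rho> \<circ> \<sigma> = \<tau> \<circ> \<rho>"
    by (simp add: fun_eq_iff)
  \<comment> \<open>The set is finite, so surjectivity already gives a permutation.\<close>
  have surj: "{1..n} \<subseteq> \<rho> ` {1..n}"
  proof
    fix y assume "y \<in> {1..n}"
    then have "orbit \<tau> y \<in> h ` orbit \<sigma> ` {1..n}"
      using h by (auto simp: bij_betw_def)
    then obtain x where x: "x \<in> {1..n}" "h (orbit \<sigma> x) = orbit \<tau> y"
      by auto
    then have "y \<in> q (orbit \<sigma> x) ` orbit \<sigma> x"
      using q(1) self by auto
    then obtain z where z: "z \<in> orbit \<sigma> x" "y = q (orbit \<sigma> x) z"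
      by blast
    have "orbit \<sigma> z = orbit \<sigma> x"
      using orbit_cyclic_eq3[OF cyc(1) z(1)] .
    moreover have "z \<in> {1..n}"
      using permutes_orbit_subset[OF \<sigma> x(1)] z(1) by blast
    ultimately have "\<rho> z = y"
      using z by (simp add: \<rho>_def)
    then show "y \<in> \<rho> ` {1..n}"
      using \<open>z \<in> {1..n}\<close> by blast
  qed
  then have "card (\<rho> ` {1..n}) \<ge> card {1..n}"
    by (intro card_mono) auto
  then have "card (\<rho> ` {1..n}) = card {1..n}"
    using card_image_le[of "{1..n}" \<rho>] by simp
  moreover from this have "\<rho> ` {1..n} = {1..n}"
    using surj by (intro card_subset_eq[symmetric]) auto
  ultimately have "bij_betw \<rho> {1..n} {1..n}"
    by (simp add: bij_betw_def eq_card_imp_inj_on)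
  then have "\<rho> permutes {1..n}"
    by (rule bij_imp_permutes) (auto simp: \<rho>_def)
  with comm show ?thesis by blast
qed

lemma irr_char_cong_cycle_type:
  assumes \<sigma>: "\<sigma> permutes {1..n}" and \<tau>: "\<tau> permutes {1..n}"
    and "cycle_type n \<sigma> = cycle_type n \<tau>"
  shows "irr_char n lam \<sigma> = irr_char n lam \<tau>"
proof -
  obtain \<rho> where \<rho>: "\<rho> permutes {1..n}" "\<rho> \<circ> \<sigma> = \<tau> \<circ> \<rho>"
    using same_cycle_type_imp_conjugate[OF assms] by blast
  have "\<sigma> = inv \<rho> \<circ> (\<tau> \<circ> \<rho>)"
    unfolding \<rho>(2)[symmetric] by (simp add: fun_eq_iff permutes_inverses[OF \<rho>(1)])
  then have "irr_char n lam \<sigma> = irr_char n lam (\<tau> \<circ> \<rho> \<circ> inv \<rho>)"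
    using irr_char_comm[of "inv \<rho>" n "\<tau> \<circ> \<rho>" lam] \<rho>(1) \<tau>
    by (simp add: permutes_inv permutes_compose)
  also have "\<tau> \<circ> \<rho> \<circ> inv \<rho> = \<tau>"
    by (simp add: fun_eq_iff permutes_inverses[OF \<rho>(1)])
  finally show ?thesis .
qed

text \<open>The character is a class function, so its value at a cycle type may be read off any representative.\<close>

lemma irr_char_type_cycle_type:
  assumes "\<sigma> permutes {1..n}"
  shows "irr_char_type n lam (cycle_type n \<sigma>) = irr_char n lam \<sigma>"
proof -
  let ?P = "\<lambda>\<tau>. \<tau> permutes {1..n} \<and> cycle_type n \<tau> = cycle_type n \<sigma>"
  have "?P (SOME \<tau>. ?P \<tau>)"
    by (rule someI[of ?P \<sigma>]) (use assms in blast)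
  then show ?thesis
    unfolding irr_char_type_def using assms irr_char_cong_cycle_type by blast
qed

section \<open>Partitions and counting by class sizes\<close>

lemma finite_partitions: "finite (partitions n)"
proof -
  have "partitions n \<subseteq> mset ` {xs. set xs \<subseteq> {..n} \<and> length xs \<le> n}"
  proof
    fix \<nu> assume \<nu>: "\<nu> \<in> partitions n"
    obtain xs where xs: "\<nu> = mset xs"
      using ex_mset by metis
    have sum: "sum_list xs = n" and pos: "\<And>x. x \<in> set xs \<Longrightarrow> 1 \<le> x"
      using \<nu> by (auto simp: partitions_def xs sum_mset_sum_list Suc_le_eq intro: gr0I)
    have "length xs * 1 \<le> sum_list xs"
      using sum_list_mono[of xs "\<lambda>_. 1" "\<lambda>x. x"] pos by (simp add: sum_list_triv)
    moreover have "x \<le> n" if "x \<in> set xs" for x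
      using member_le_sum_list[OF that] sum by simp
    ultimately show "\<nu> \<in> mset ` {xs. set xs \<subseteq> {..n} \<and> length xs \<le> n}"
      using sum xs by auto
  qed
  then show ?thesis
    by (rule finite_subset) (intro finite_imageI finite_lists_length_le finite_atMost)
qed

text \<open>The parts equal to 1 are determined by the larger parts and the total.\<close>

lemma partitions_eqI:
  assumes \<mu>: "\<mu> \<in> partitions n" and \<nu>: "\<nu> \<in> partitions n"
    and eq: "\<And>j. 2 \<le> j \<Longrightarrow> j \<le> n \<Longrightarrow> count \<mu> j = count \<nu> j"
  shows "\<mu> = \<nu>"
proof -
  define big where "big = filter_mset (\<lambda>j :: nat. 2 \<le> j)"
  have split: "\<kappa> = replicate_mset (count \<kappa> 1) 1 + big \<kappa>" if "\<kappa> \<in> partitions n" for \<kappa>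
  proof (rule multiset_eqI)
    fix j :: nat
    have "count \<kappa> 0 = 0"
      using that by (simp add: partitions_def not_in_iff)
    moreover have "j = 0 \<or> j = 1 \<or> j \<ge> 2" by auto
    ultimately show "count \<kappa> j = count (replicate_mset (count \<kappa> 1) 1 + big \<kappa>) j"
      by (auto simp: big_def)
  qed
  have large: "count \<kappa> j = 0" if "\<kappa> \<in> partitions n" "j > n" for \<kappa> j
  proof -
    have "j \<notin># \<kappa>"
      using that by (auto simp: partitions_def dest!: multi_member_split)
    then show ?thesis by (simp add: not_in_iff)
  qed
  have big: "big \<mu> = big \<nu>"
  proof (rule multiset_eqI)
    fix j show "count (big \<mu>) j = count (big \<nu>) j"
      using eq large[OF \<mu>, of j] large[OF \<nu>, of j] by (cases "j > n") (auto simp: big_def)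
  qed
  have "count \<kappa> 1 + sum_mset (big \<kappa>) = n" if "\<kappa> \<in> partitions n" for \<kappa>
  proof -
    have "sum_mset \<kappa> = sum_mset (replicate_mset (count \<kappa> 1) 1 + big \<kappa>)"
      using split[OF that] by simp
    then show ?thesis
      using that by (simp add: partitions_def)
  qed
  from this[OF \<mu>] this[OF \<nu>] have "count \<mu> 1 = count \<nu> 1"
    using big by simp
  then show ?thesis
    using split[OF \<mu>] split[OF \<nu>] big by simp
qed

text \<open>Choosing a subset of \<open>A\<close> amounts to choosing its part in each class of \<open>w\<close> independently.\<close>

lemma card_subsets_with_class_sizes:
  fixes w :: "'a \<Rightarrow> 'b"
  assumes A: "finite A" and J: "finite J" "w ` A \<subseteq> J"
  shows "card {S. S \<subseteq> A \<and> (\<forall>j\<in>J. card {a \<in> S. w a = j} = m j)} =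
    (\<Prod>j\<in>J. card {a \<in> A. w a = j} choose m j)"
proof -
  define split where "split = (\<lambda>S. \<lambda>j\<in>J. {a \<in> S. w a = j})"
  define T where "T = (\<lambda>j. {K. K \<subseteq> {a \<in> A. w a = j} \<and> card K = m j})"
  have Un: "(\<Union>j\<in>J. split S j) = S" if "S \<subseteq> A" for S
    using that J(2) by (auto simp: split_def)
  have "bij_betw split {S. S \<subseteq> A \<and> (\<forall>j\<in>J. card {a \<in> S. w a = j} = m j)} (PiE J T)"
  proof (rule bij_betw_byWitness[of _ "\<lambda>F. \<Union>j\<in>J. F j"])
    show "\<forall>F\<in>PiE J T. split (\<Union>j\<in>J. F j) = F"
    proof
      fix F assume F: "F \<in> PiE J T"
      show "split (\<Union>j\<in>J. F j) = F"
      proof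
        fix j
        show "split (\<Union>j\<in>J. F j) j = F j"
        proof (cases "j \<in> J")
          case True
          then show ?thesis
            using PiE_mem[OF F] unfolding split_def T_def by auto
        next
          case False
          then show ?thesis
            using F PiE_arb[OF F] by (simp add: split_def)
        qed
      qed
    qed
    show "(\<lambda>F. \<Union>j\<in>J. F j) ` PiE J T \<subseteq>
        {S. S \<subseteq> A \<and> (\<forall>j\<in>J. card {a \<in> S. w a = j} = m j)}"
    proof safe
      fix F a j assume F: "F \<in> PiE J T" "j \<in> J" "a \<in> F j"
      then show "a \<in> A"
        using PiE_mem[OF F(1,2)] by (auto simp: T_def)
    next
      fix F i assume F: "F \<in> PiE J T" and i: "i \<in> J"
      have "{a \<in> (\<Union>j\<in>J. F j). w a = i} = F i"
        using PiE_mem[OF F] i by (auto simp: T_def)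
      then show "card {a \<in> (\<Union>j\<in>J. F j). w a = i} = m i"
        using PiE_mem[OF F i] by (simp add: T_def)
    qed
  qed (use Un in \<open>auto simp: split_def T_def\<close>)
  then have "card {S. S \<subseteq> A \<and> (\<forall>j\<in>J. card {a \<in> S. w a = j} = m j)} = (\<Prod>j\<in>J. card (T j))"
    using J(1) by (simp add: bij_betw_same_card card_PiE)
  also have "\<dots> = (\<Prod>j\<in>J. card {a \<in> A. w a = j} choose m j)"
    unfolding T_def using A by (intro prod.cong refl n_subsets) auto
  finally show ?thesis .
qed

section \<open>Character sums over the cycles of a map\<close>

text \<open>The permutations that follow the arrows of \<open>f\<close> at every point they move. They are
  what remains of the sum over the symmetric group in the immanant once the arrows have been fixed.\<close>

definition sub_permutations :: "nat \<Rightarrow> nat set \<Rightarrow> (nat \<Rightarrow> nat) \<Rightarrow> (nat \<Rightarrow> nat) set" where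
  "sub_permutations n B f =
     {\<psi>. \<psi> permutes {1..n} \<and> (\<forall>i. \<psi> i \<noteq> i \<longrightarrow> i \<in> B \<and> \<psi> i = f i)}"

text \<open>Requiring \<open>C \<subseteq> B\<close> for the whole cycle matters: an orientation takes the value \<^const>\<open>undefined\<close>
  outside \<open>B\<close>, and this number may happen to lie in \<open>B\<close> again.\<close>

definition cycles_within :: "nat set \<Rightarrow> (nat \<Rightarrow> nat) \<Rightarrow> nat set set" where
  "cycles_within B f = {C. C \<subseteq> B \<and> cyclic_on f C}"

abbreviation union_perm :: "('a \<Rightarrow> 'a) \<Rightarrow> 'a set set \<Rightarrow> 'a \<Rightarrow> 'a" where
  "union_perm f S \<equiv> perm_restrict f (\<Union>S)"

lemma cyclic_on_same:
  assumes "cyclic_on f C" "cyclic_on f D" "x \<in> C" "x \<in> D"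
  shows "C = D"
  using assms orbit_cyclic_eq3 by metis

lemma cyclic_on_image_eq:
  assumes "cyclic_on f C"
  shows "f ` C = C" "inj_on f C"
proof -
  have fin: "finite C"
    using assms by (rule finite_cyclic_on)
  have "y \<in> f ` C" if y: "y \<in> C" for y
  proof -
    have "y \<in> orbit f y" "C = orbit f y"
      using assms y by (auto simp: cyclic_on_alldef)
    from this(1) show ?thesis
    proof cases
      case base
      then show ?thesis using y by auto
    next
      case (step z)
      then show ?thesis using \<open>C = orbit f y\<close> by auto
    qed
  qed
  then show eq: "f ` C = C"
    using cyclic_on_inI[OF assms] by auto
  then show "inj_on f C"
    using fin by (simp add: eq_card_imp_inj_on)
qed

context
  fixes n :: nat and B :: "nat set" and f :: "nat \<Rightarrow> nat"
  assumes B: "B \<subseteq> {1..n}" and loop_free: "\<And>v. v \<in> B \<Longrightarrow> f v \<noteq> v"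
begin

abbreviation (input) "Cyc \<equiv> cycles_within B f"

lemma finite_cycles_within: "finite Cyc"
  unfolding cycles_within_def
  by (rule finite_subset[of _ "Pow {1..n}"]) (use B in auto)

lemma cycles_within_cyclic: "S \<subseteq> Cyc \<Longrightarrow> C \<in> S \<Longrightarrow> cyclic_on f C"
  by (auto simp: cycles_within_def)

lemma Union_cycles_subset: "S \<subseteq> Cyc \<Longrightarrow> \<Union>S \<subseteq> {1..n}"
  using B by (auto simp: cycles_within_def)

lemma card_cycle_bounds:
  assumes "C \<in> Cyc"
  shows "2 \<le> card C" "card C \<le> n"
proof -
  have C: "C \<subseteq> B" "cyclic_on f C"
    using assms by (auto simp: cycles_within_def)
  obtain x where x: "x \<in> C"
    using C(2) by (auto simp: cyclic_on_def)
  have "card {x, f x} \<le> card C"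
    using x cyclic_on_inI[OF C(2) x] finite_cyclic_on[OF C(2)] by (intro card_mono) auto
  moreover have "f x \<noteq> x"
    using loop_free x C(1) by blast
  ultimately show "2 \<le> card C"
    by (simp add: card_insert_if)
  show "card C \<le> n"
    using card_mono[of "{1..n}" C] C(1) B by auto
qed

lemma union_perm_permutes:
  assumes S: "S \<subseteq> Cyc"
  shows "union_perm f S permutes {1..n}"
proof -
  have "f ` \<Union>S = \<Union>S"
    using cyclic_on_image_eq(1)[OF cycles_within_cyclic[OF S]] by (simp add: image_Union)
  moreover have "finite (\<Union>S)"
    using Union_cycles_subset[OF S] finite_subset by blast
  ultimately have "bij_betw f (\<Union>S) (\<Union>S)"
    by (simp add: bij_betw_def eq_card_imp_inj_on)
  then have "bij_betw (union_perm f S) (\<Union>S) (\<Union>S)"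
    by (subst bij_betw_cong[of _ _ f]) (simp_all add: perm_restrict_simps)
  then have "union_perm f S permutes \<Union>S"
    by (rule bij_imp_permutes) (simp add: perm_restrict_simps)
  then show ?thesis
    using Union_cycles_subset[OF S] by (rule permutes_subset)
qed

text \<open>The cycles of a map are pairwise disjoint, so a set of cycles can be recovered from its union.\<close>

lemma Union_cycles_inj:
  assumes "S \<subseteq> Cyc" "S' \<subseteq> Cyc" "\<Union>S \<subseteq> \<Union>S'"
  shows "S \<subseteq> S'"
proof
  fix C assume C: "C \<in> S"
  then obtain x where x: "x \<in> C"
    using cycles_within_cyclic[OF assms(1)] by (fastforce simp: cyclic_on_def)
  then obtain D where D: "D \<in> S'" "x \<in> D"
    using C assms(3) by auto
  then have "C = D"
    using x C cycles_within_cyclic[OF assms(1)] cycles_within_cyclic[OF assms(2)]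
      cyclic_on_same by metis
  then show "C \<in> S'" using D by simp
qed

lemma Union_cycles_moved:
  assumes "S \<subseteq> Cyc"
  shows "\<Union>S = {x. union_perm f S x \<noteq> x}"
  using assms loop_free by (auto simp: perm_restrict_def cycles_within_def)

text \<open>A permutation that follows \<open>f\<close> wherever it moves is the product of a set of directed cycles of \<open>f\<close>,
  and every set of directed cycles arises once.\<close>

lemma bij_betw_union_perm: "bij_betw (union_perm f) (Pow Cyc) (sub_permutations n B f)"
proof (rule bij_betwI')
  fix S S' assume "S \<in> Pow Cyc" "S' \<in> Pow Cyc"
  then show "union_perm f S = union_perm f S' \<longleftrightarrow> S = S'"
    using Union_cycles_moved[of S] Union_cycles_moved[of S'] Union_cycles_inj[of S S']
      Union_cycles_inj[of S' S] by (metis Pow_iff order_refl subset_antisym)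
next
  fix S assume "S \<in> Pow Cyc"
  then show "union_perm f S \<in> sub_permutations n B f"
    using union_perm_permutes
    by (auto simp: sub_permutations_def perm_restrict_def cycles_within_def)
next
  fix \<psi> assume \<psi>: "\<psi> \<in> sub_permutations n B f"
  then have perm: "\<psi> permutes {1..n}" and agree: "\<And>i. \<psi> i \<noteq> i \<Longrightarrow> i \<in> B \<and> \<psi> i = f i"
    by (auto simp: sub_permutations_def)
  have cyc: "cyclic_on \<psi> (orbit \<psi> x)" for x
    using perm by (auto intro: cyclic_on_orbit)
  have moved: "\<psi> y \<noteq> y" if "\<psi> x \<noteq> x" "y \<in> orbit \<psi> x" for x y
  proof
    assume "\<psi> y = y"
    then have "orbit \<psi> x = {y}"
      using orbit_cyclic_eq3[OF cyc that(2)] by (simp add: orbit_eq_singleton_iff[THEN iffD2])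
    moreover have "x \<in> orbit \<psi> x"
      using perm by (auto intro!: permutation_self_in_orbit permutation_permutes[THEN iffD2])
    ultimately show False
      using that \<open>\<psi> y = y\<close> by auto
  qed
  define S where "S = {orbit \<psi> x | x. \<psi> x \<noteq> x}"
  have "S \<subseteq> Cyc"
  proof
    fix C assume "C \<in> S"
    then obtain x where x: "\<psi> x \<noteq> x" "C = orbit \<psi> x"
      by (auto simp: S_def)
    have "cyclic_on f C = cyclic_on \<psi> C"
      using moved agree x by (intro cyclic_cong) auto
    then show "C \<in> Cyc"
      using cyc moved agree x by (auto simp: cycles_within_def)
  qed
  moreover have "x \<in> \<Union>S \<longleftrightarrow> \<psi> x \<noteq> x" for x
    using perm moved
    by (auto simp: S_def intro!: permutation_self_in_orbit permutation_permutes[THEN iffD2])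
  then have "union_perm f S = \<psi>"
    using agree by (auto simp: perm_restrict_def fun_eq_iff)
  ultimately show "\<exists>S\<in>Pow Cyc. \<psi> = union_perm f S"
    by blast
qed

lemma orbit_union_perm:
  assumes "S \<subseteq> Cyc"
  shows "C \<in> S \<Longrightarrow> x \<in> C \<Longrightarrow> orbit (union_perm f S) x = C"
    and "x \<notin> \<Union>S \<Longrightarrow> orbit (union_perm f S) x = {x}"
proof -
  assume C: "C \<in> S" "x \<in> C"
  have "cyclic_on (union_perm f S) C = cyclic_on f C"
    using C by (intro cyclic_cong) (auto simp: perm_restrict_def)
  then show "orbit (union_perm f S) x = C"
    using cycles_within_cyclic[OF assms C(1)] C(2) by (simp add: orbit_cyclic_eq3)
qed (simp add: orbit_eq_singleton_iff perm_restrict_simps)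

lemma cycle_type_union_perm:
  assumes S: "S \<subseteq> Cyc"
  shows "cycle_type n (union_perm f S) =
    image_mset card (mset_set S) + replicate_mset (n - card (\<Union>S)) 1"
proof -
  let ?U = "\<Union>S" and ?p = "union_perm f S"
  have U: "?U \<subseteq> {1..n}" by (rule Union_cycles_subset[OF S])
  have "orbit ?p ` ?U = S"
  proof (intro equalityI subsetI)
    fix C assume C: "C \<in> S"
    then obtain x where x: "x \<in> C"
      using cycles_within_cyclic[OF S] by (fastforce simp: cyclic_on_def)
    then show "C \<in> orbit ?p ` ?U"
      using orbit_union_perm(1)[OF S C x] C by (intro rev_image_eqI[of x]) auto
  qed (use orbit_union_perm(1)[OF S] in auto)
  moreover have "orbit ?p ` ({1..n} - ?U) = (\<lambda>x. {x}) ` ({1..n} - ?U)"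
    using orbit_union_perm(2)[OF S] by (intro image_cong) auto
  moreover have "{1..n} = ?U \<union> ({1..n} - ?U)"
    using U by auto
  ultimately have orbits: "orbit ?p ` {1..n} = S \<union> (\<lambda>x. {x}) ` ({1..n} - ?U)"
    by (metis image_Un)
  have "finite S"
    using S finite_cycles_within finite_subset by blast
  have disj: "S \<inter> (\<lambda>x. {x}) ` ({1..n} - ?U) = {}"
    by auto
  have "card ({1..n} - ?U) = n - card ?U"
    using U by (simp add: card_Diff_subset finite_subset[OF U])
  then have "image_mset card (mset_set ((\<lambda>x. {x}) ` ({1..n} - ?U))) =
      replicate_mset (n - card ?U) (1 :: nat)"
    by (simp add: image_mset_mset_set[symmetric] multiset.map_comp comp_def image_mset_const_eq)
  then show ?thesis
    unfolding cycle_type_def orbits using disj \<open>finite S\<close>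
    by (subst mset_set_Union) auto
qed

lemma sum_card_cycles:
  assumes "S \<subseteq> Cyc"
  shows "(\<Sum>C\<in>S. card C) = card (\<Union>S)"
proof (rule card_Union_disjoint[symmetric])
  show "pairwise disjnt S"
    using cyclic_on_same[OF cycles_within_cyclic[OF assms] cycles_within_cyclic[OF assms]]
    unfolding pairwise_def disjnt_iff by auto
qed (rule finite_cyclic_on[OF cycles_within_cyclic[OF assms]])

lemma card_Union_cycles_le: "S \<subseteq> Cyc \<Longrightarrow> card (\<Union>S) \<le> n"
  using Union_cycles_subset card_mono[of "{1..n}"] by fastforce

lemma cycle_type_union_perm_in_partitions:
  assumes S: "S \<subseteq> Cyc"
  shows "cycle_type n (union_perm f S) \<in> partitions n"
proof -
  have "sum_mset (image_mset card (mset_set S)) = card (\<Union>S)"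
    using sum_card_cycles[OF S] by (simp add: sum_unfold_sum_mset)
  then have "sum_mset (cycle_type n (union_perm f S)) = n"
    using card_Union_cycles_le[OF S] unfolding cycle_type_union_perm[OF S] by simp
  moreover have "finite S"
    using S finite_cycles_within finite_subset by blast
  then have "0 \<notin># cycle_type n (union_perm f S)"
    unfolding cycle_type_union_perm[OF S] using S card_cycle_bounds(1)
    by (fastforce split: if_splits)
  ultimately show ?thesis
    by (simp add: partitions_def)
qed

lemma count_cycle_type_union_perm:
  assumes S: "S \<subseteq> Cyc" and j: "2 \<le> j"
  shows "count (cycle_type n (union_perm f S)) j = card {C \<in> S. card C = j}"
proof -
  have "finite S"
    using S finite_cycles_within finite_subset by blast
  then show ?thesis
    unfolding cycle_type_union_perm[OF S] using j
    by (simp add: count_image_mset_eq_card_vimage)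
qed

lemma card_union_perm_cycle_type:
  assumes \<nu>: "\<nu> \<in> partitions n"
  shows "card {S \<in> Pow Cyc. cycle_type n (union_perm f S) = \<nu>} =
    (\<Prod>j = 2..n. card {C \<in> Cyc. card C = j} choose count \<nu> j)"
proof -
  have "cycle_type n (union_perm f S) = \<nu> \<longleftrightarrow>
      (\<forall>j\<in>{2..n}. card {C \<in> S. card C = j} = count \<nu> j)" if S: "S \<subseteq> Cyc" for S
    using partitions_eqI[OF cycle_type_union_perm_in_partitions[OF S] \<nu>]
      count_cycle_type_union_perm[OF S] by auto
  then have "{S \<in> Pow Cyc. cycle_type n (union_perm f S) = \<nu>} =
      {S. S \<subseteq> Cyc \<and> (\<forall>j\<in>{2..n}. card {C \<in> S. card C = j} = count \<nu> j)}"
    by auto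
  then show ?thesis
    using card_cycle_bounds finite_cycles_within
    by (simp add: card_subsets_with_class_sizes image_subset_iff)
qed

text \<open>Grouping the sets of cycles by cycle type: the factor of the product at \<open>j\<close> counts the ways to
  select the prescribed number of cycles of length \<open>j\<close>.\<close>

lemma sum_irr_char_sub_permutations:
  "(\<Sum>\<psi>\<in>sub_permutations n B f. irr_char n lam \<psi>) =
   (\<Sum>\<nu>\<in>partitions n. irr_char_type n lam \<nu> *
      of_nat (\<Prod>j = 2..n. card {C \<in> Cyc. card C = j} choose count \<nu> j))"
proof -
  let ?type = "\<lambda>S. cycle_type n (union_perm f S)"
  have "(\<Sum>\<psi>\<in>sub_permutations n B f. irr_char n lam \<psi>) =
      (\<Sum>S\<in>Pow Cyc. irr_char n lam (union_perm f S))"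
    by (rule sum.reindex_bij_betw[OF bij_betw_union_perm, symmetric])
  also have "\<dots> = (\<Sum>S\<in>Pow Cyc. irr_char_type n lam (?type S))"
    using union_perm_permutes by (intro sum.cong refl irr_char_type_cycle_type[symmetric]) auto
  also have "\<dots> = (\<Sum>\<nu>\<in>partitions n. \<Sum>S\<in>{S \<in> Pow Cyc. ?type S = \<nu>}. irr_char_type n lam (?type S))"
    using cycle_type_union_perm_in_partitions finite_cycles_within finite_partitions
    by (intro sum.group[symmetric]) auto
  also have "\<dots> = (\<Sum>\<nu>\<in>partitions n. irr_char_type n lam \<nu> *
      of_nat (\<Prod>j = 2..n. card {C \<in> Cyc. card C = j} choose count \<nu> j))"
  proof (intro sum.cong refl)
    fix \<nu> assume \<nu>: "\<nu> \<in> partitions n"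
    have "(\<Sum>S\<in>{S \<in> Pow Cyc. ?type S = \<nu>}. irr_char_type n lam (?type S)) =
        (\<Sum>S\<in>{S \<in> Pow Cyc. ?type S = \<nu>}. irr_char_type n lam \<nu>)"
      by (intro sum.cong refl) simp
    then show "(\<Sum>S\<in>{S \<in> Pow Cyc. ?type S = \<nu>}. irr_char_type n lam (?type S)) =
        irr_char_type n lam \<nu> *
        of_nat (\<Prod>j = 2..n. card {C \<in> Cyc. card C = j} choose count \<nu> j)"
      unfolding card_union_perm_cycle_type[OF \<nu>, symmetric] by (simp add: mult.commute)
  qed
  finally show ?thesis .
qed

text \<open>On a cycle that belongs to both sets the two factors cancel. On a cycle in exactly one of the sets the
  quotient acts as \<open>f\<close> or as its inverse, and these have the same orbits.\<close>

lemma cycle_type_quotient: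
  assumes S: "S \<subseteq> Cyc" and S': "S' \<subseteq> Cyc"
  shows "cycle_type n (union_perm f S \<circ> inv (union_perm f S')) =
    cycle_type n (union_perm f (sym_diff S S'))"
proof -
  let ?p = "union_perm f S" and ?q = "union_perm f S'" and ?d = "union_perm f (sym_diff S S')"
  have D: "sym_diff S S' \<subseteq> Cyc" using S S' by auto
  have bij: "bij ?q"
    using union_perm_permutes[OF S'] by (rule permutes_bij)
  have fixed: "inv ?q x = x" if "x \<notin> \<Union>S'" for x
    using that bij_inv_eq_iff[OF bij, of x x] perm_restrict_simps(2)[OF that, of f] by simp
  have unique: "C = D" if "C \<in> S \<union> S'" "D \<in> S \<union> S'" "x \<in> C" "x \<in> D" for C D x
    using that S S' by (intro cyclic_on_same[of f C D x]) (auto simp: cycles_within_def)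
  have inside: "inv ?q x \<in> C" if "C \<in> S'" "x \<in> C" for C x
  proof -
    have "inv ?q x \<in> orbit (inv ?q) x" by (rule orbit.base)
    also have "orbit (inv ?q) x = orbit ?q x"
      using union_perm_permutes[OF S'] by (auto intro!: orbit_inv_eq permutation_permutes[THEN iffD2])
    finally show ?thesis
      using orbit_union_perm(1)[OF S' that] by simp
  qed
  have "orbit (?p \<circ> inv ?q) x = orbit ?d x" for x
  proof (cases "x \<in> \<Union>S \<union> \<Union>S'")
    case False
    then have "orbit (?p \<circ> inv ?q) x = {x}"
      by (simp add: orbit_eq_singleton_iff fixed perm_restrict_simps)
    moreover have "x \<notin> \<Union>(sym_diff S S')"
      using False by auto
    ultimately show ?thesis
      using orbit_union_perm(2)[OF D] by simp
  next
    case True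
    then obtain C where C: "C \<in> S \<union> S'" "x \<in> C" by auto
    have in_Un: "y \<in> \<Union>T \<longleftrightarrow> C \<in> T" if "T \<subseteq> S \<union> S'" "y \<in> C" for T y
      using that C unique by blast
    consider "C \<in> S" "C \<notin> S'" | "C \<notin> S" "C \<in> S'" | "C \<in> S" "C \<in> S'"
      using C by auto
    then show ?thesis
    proof cases
      case 1
      have "cyclic_on (?p \<circ> inv ?q) C = cyclic_on f C"
        using 1 in_Un by (intro cyclic_cong) (simp add: fixed perm_restrict_simps)
      then have "orbit (?p \<circ> inv ?q) x = C"
        using C 1 cycles_within_cyclic[OF S] by (simp add: orbit_cyclic_eq3)
      moreover have "orbit ?d x = C"
        using 1 C by (intro orbit_union_perm(1)[OF D]) auto
      ultimately show ?thesis by simp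
    next
      case 2
      have "orbit (inv ?q) x = C"
        using union_perm_permutes[OF S'] orbit_union_perm(1)[OF S' 2(2) C(2)]
        by (subst orbit_inv_eq) (auto intro!: permutation_permutes[THEN iffD2])
      moreover have "orbit (inv ?q) x = orbit (?p \<circ> inv ?q) x"
        using inside[OF 2(2)] in_Un[of S] 2
        by (intro orbit_cong0[of x C]) (auto simp: C perm_restrict_simps)
      moreover have "orbit ?d x = C"
        using 2 C by (intro orbit_union_perm(1)[OF D]) auto
      ultimately show ?thesis by simp
    next
      case 3
      have "?p y = ?q y" if "y \<in> C" for y
        using 3 in_Un[of S] in_Un[of S'] that by (simp add: perm_restrict_simps)
      then have "(?p \<circ> inv ?q) x = ?q (inv ?q x)"
        using inside[OF 3(2) C(2)] by simp
      also have "\<dots> = x"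
        using bij by (simp add: bij_is_surj surj_f_inv_f)
      finally have "orbit (?p \<circ> inv ?q) x = {x}"
        by (simp add: orbit_eq_singleton_iff)
      moreover have "x \<notin> \<Union>(sym_diff S S')"
        using in_Un[of "sym_diff S S'" x] 3 C by auto
      ultimately show ?thesis
        using orbit_union_perm(2)[OF D] by simp
    qed
  qed
  then show ?thesis
    by (simp add: cycle_type_def)
qed

text \<open>By positive definiteness the double sum of \<open>\<chi>(g\<^sub>S g\<^sub>T\<inverse>)\<close> over all pairs of sets \<open>S\<close>, \<open>T\<close> of
  cycles is non-negative, where \<open>g\<^sub>S\<close> is the product of the cycles in \<open>S\<close>. Its terms depend only on the
  symmetric difference of \<open>S\<close> and \<open>T\<close>, so each inner sum equals the sum of \<open>\<chi>(g\<^sub>S)\<close> over all \<open>S\<close>.\<close>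

lemma sum_irr_char_sub_permutations_nonneg:
  "\<exists>t\<ge>0. (\<Sum>\<psi>\<in>sub_permutations n B f. irr_char n lam \<psi>) = complex_of_real t"
proof -
  let ?\<chi> = "irr_char n lam"
  define s where "s = (\<Sum>S\<in>Pow Cyc. ?\<chi> (union_perm f S))"
  obtain t where t: "t \<ge> 0"
    "(\<Sum>S\<in>Pow Cyc. \<Sum>S'\<in>Pow Cyc. ?\<chi> (union_perm f S \<circ> inv (union_perm f S'))) = complex_of_real t"
    using irr_char_positive_definite[of "Pow Cyc" "union_perm f" n lam] union_perm_permutes by auto
  have "(\<Sum>S'\<in>Pow Cyc. ?\<chi> (union_perm f S \<circ> inv (union_perm f S'))) = s" if S: "S \<in> Pow Cyc" for S
  proof -
    have "(\<Sum>S'\<in>Pow Cyc. ?\<chi> (union_perm f S \<circ> inv (union_perm f S'))) =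
        (\<Sum>S'\<in>Pow Cyc. ?\<chi> (union_perm f (sym_diff S S')))"
      using S by (intro sum.cong refl irr_char_cong_cycle_type cycle_type_quotient
          permutes_compose permutes_inv union_perm_permutes) auto
    also have "\<dots> = s"
      unfolding s_def using S
      by (intro sum.reindex_bij_witness[of _ "sym_diff S" "sym_diff S"]) auto
    finally show ?thesis .
  qed
  then have "of_nat (card (Pow Cyc)) * s = complex_of_real t"
    using t(2) by simp
  moreover have "card (Pow Cyc) > 0"
    using finite_cycles_within by (auto simp: card_gt_0_iff)
  ultimately have "s = complex_of_real (t / card (Pow Cyc))"
    by (simp add: field_simps)
  moreover have "(\<Sum>\<psi>\<in>sub_permutations n B f. ?\<chi> \<psi>) = s"
    unfolding s_def by (rule sum.reindex_bij_betw[OF bij_betw_union_perm, symmetric])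
  ultimately show ?thesis
    using t(1) by (intro exI[of _ "t / card (Pow Cyc)"]) simp
qed

lemma sum_irr_char_sub_permutations_in_Nats:
  "(\<Sum>\<psi>\<in>sub_permutations n B f. irr_char n lam \<psi>) \<in> \<nat>"
proof -
  let ?s = "\<Sum>\<psi>\<in>sub_permutations n B f. irr_char n lam \<psi>"
  have "?s \<in> \<int>"
    by (intro Ints_sum irr_char_in_Ints) (auto simp: sub_permutations_def)
  then obtain k where k: "?s = of_int k"
    by (auto simp: Ints_def)
  obtain t where "t \<ge> 0" "?s = complex_of_real t"
    using sum_irr_char_sub_permutations_nonneg by blast
  then have "k \<ge> 0"
    using k by (metis of_int_0_le_iff of_real_eq_iff of_real_of_int_eq)
  then show ?thesis
    unfolding k by (metis of_int_of_nat_eq of_nat_in_Nats nat_0_le)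
qed

end

section \<open>Cycles and types of orientations of bipartite graphs\<close>

lemma simple_graph_edge:
  assumes "simple_graph n E" "{u, v} \<in> E"
  shows "u \<in> {1..n}" "v \<in> {1..n}" "u \<noteq> v"
proof -
  have "{u, v} \<subseteq> {1..n}" "card {u, v} = 2"
    using assms by (auto simp: simple_graph_def)
  then show "u \<in> {1..n}" "v \<in> {1..n}" "u \<noteq> v"
    by auto
qed

lemma finite_neighbours:
  assumes "simple_graph n E"
  shows "finite (neighbours E v)"
  by (rule finite_subset[of _ "{1..n}"])
    (use simple_graph_edge[OF assms] in \<open>auto simp: neighbours_def\<close>)

lemma orientation_edge: "f \<in> orientations E B \<Longrightarrow> v \<in> B \<Longrightarrow> {v, f v} \<in> E"
  by (auto simp: orientations_def neighbours_def)

lemma finite_orientations: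
  assumes "simple_graph n E" "B \<subseteq> {1..n}"
  shows "finite (orientations E B)"
  unfolding orientations_def
  using finite_neighbours[OF assms(1)] finite_subset[OF assms(2)] by (intro finite_PiE) auto

text \<open>The map \<open>f\<close> exchanges the two colour classes within \<open>C\<close>, injectively in both directions.\<close>

lemma even_card_bipartite:
  assumes bip: "bipartite_graph n E" and fin: "finite C" and inj: "inj_on f C"
    and closed: "f ` C \<subseteq> C" and edge: "\<And>v. v \<in> C \<Longrightarrow> {v, f v} \<in> E"
  shows "even (card C)"
proof -
  obtain X Y where disj: "X \<inter> Y = {}" and E: "\<And>e. e \<in> E \<Longrightarrow> \<exists>x\<in>X. \<exists>y\<in>Y. e = {x, y}"
    using bip by (auto simp: bipartite_graph_def)
  have side: "v \<in> X \<and> f v \<in> Y \<or> v \<in> Y \<and> f v \<in> X" if "v \<in> C" for v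
    using E[OF edge[OF that]] by (auto simp: doubleton_eq_iff)
  have XY: "f ` (C \<inter> X) \<subseteq> C \<inter> Y" and YX: "f ` (C \<inter> Y) \<subseteq> C \<inter> X"
    using side closed disj by blast+
  have "card (C \<inter> X) \<le> card (C \<inter> Y)"
    by (rule card_inj_on_le[OF inj_on_subset[OF inj] XY]) (use fin in auto)
  moreover have "card (C \<inter> Y) \<le> card (C \<inter> X)"
    by (rule card_inj_on_le[OF inj_on_subset[OF inj] YX]) (use fin in auto)
  moreover have "card C = card (C \<inter> X) + card (C \<inter> Y)"
  proof -
    have "C = (C \<inter> X) \<union> (C \<inter> Y)"
      using side by blast
    then show ?thesis
      using card_Un_disjoint[of "C \<inter> X" "C \<inter> Y"] fin disj by auto
  qed
  ultimately show ?thesis by simp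
qed

lemma bidirected_edges_eq:
  assumes G: "simple_graph n E" and f: "f \<in> orientations E B"
  shows "bidirected_edges E B f = {C \<in> cycles_within B f. card C = 2}"
proof (intro equalityI subsetI)
  fix e assume "e \<in> bidirected_edges E B f"
  then obtain u v where uv: "e = {u, v}" "u \<in> B" "v \<in> B" "f u = v" "f v = u" "{u, v} \<in> E"
    by (auto simp: bidirected_edges_def)
  have "orbit f u = {(f ^^ m) u |m. m < 2}"
    by (rule orbit_altdef_bounded) (use uv in \<open>simp_all add: numeral_2_eq_2\<close>)
  also have "\<dots> = {u, v}"
    using uv(4) by (auto simp: less_2_cases_iff intro: exI[of _ 0] exI[of _ "Suc 0"])
  finally have "cyclic_on f e"
    using uv(1) by (auto simp: cyclic_on_def)
  then show "e \<in> {C \<in> cycles_within B f. card C = 2}"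
    using uv simple_graph_edge(3)[OF G uv(6)] by (simp add: cycles_within_def)
next
  fix C assume "C \<in> {C \<in> cycles_within B f. card C = 2}"
  then have C: "C \<subseteq> B" "cyclic_on f C" "card C = 2"
    by (auto simp: cycles_within_def)
  obtain u where u: "u \<in> C"
    using C(2) by (auto simp: cyclic_on_def)
  have "(f ^^ 2) u = u"
    using cyclic_on_power_bij(2)[OF C(2) u] C(3) by simp
  then have ffu: "f (f u) = u"
    by (simp add: numeral_2_eq_2)
  have fu: "f u \<in> C"
    using C(2) u by (rule cyclic_on_inI)
  have edge: "{u, f u} \<in> E"
    using f u C(1) by (auto intro: orientation_edge)
  then have "u \<noteq> f u"
    using simple_graph_edge(3)[OF G] by blast
  then have "C = {u, f u}"
    using C(3) u fu by (intro card_subset_eq[symmetric] card_ge_0_finite) auto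
  then show "C \<in> bidirected_edges E B f"
    using edge ffu u fu C(1) unfolding bidirected_edges_def by blast
qed

text \<open>The arrow set of a directed cycle and its vertex set determine each other, so the directed cycles can be
  counted as cyclic subsets.\<close>

lemma directed_cycles_eq:
  assumes k: "k > 0"
  shows "directed_cycles B f k =
    (\<lambda>C. (\<lambda>v. (v, f v)) ` C) ` {C \<in> cycles_within B f. card C = k}"
proof -
  have "{C \<in> cycles_within B f. card C = k} = {set vs | vs. length vs = k \<and> distinct vs \<and>
      set vs \<subseteq> B \<and> (\<forall>i<k. f (vs ! i) = vs ! (Suc i mod k))}"
  proof (intro equalityI subsetI)
    fix C assume "C \<in> {C \<in> cycles_within B f. card C = k}"
    then have C: "C \<subseteq> B" "cyclic_on f C" "card C = k"
      by (auto simp: cycles_within_def)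
    obtain u where u: "u \<in> C"
      using C(2) by (auto simp: cyclic_on_def)
    note pow = cyclic_on_power_bij[OF C(2) u, unfolded C(3)]
    define vs where "vs = map (\<lambda>i. (f ^^ i) u) [0..<k]"
    have "set vs = C"
      using pow(1) by (simp add: vs_def bij_betw_def lessThan_atLeast0)
    moreover have "distinct vs"
      using pow(1) by (simp add: vs_def distinct_map bij_betw_def lessThan_atLeast0)
    moreover have "f (vs ! i) = vs ! (Suc i mod k)" if "i < k" for i
    proof (cases "Suc i = k")
      case True
      then have "f (vs ! i) = (f ^^ k) u"
        using that by (auto simp: vs_def)
      then show ?thesis
        using True k pow(2) by (simp add: vs_def)
    qed (use that in \<open>simp add: vs_def\<close>)
    ultimately show "C \<in> {set vs | vs. length vs = k \<and> distinct vs \<and>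
      set vs \<subseteq> B \<and> (\<forall>i<k. f (vs ! i) = vs ! (Suc i mod k))}"
      using C(1) by (intro CollectI exI[of _ vs]) (simp add: vs_def)
  next
    fix C assume "C \<in> {set vs | vs. length vs = k \<and> distinct vs \<and>
      set vs \<subseteq> B \<and> (\<forall>i<k. f (vs ! i) = vs ! (Suc i mod k))}"
    then obtain vs where vs: "C = set vs" "length vs = k" "distinct vs" "set vs \<subseteq> B"
        "\<And>i. i < k \<Longrightarrow> f (vs ! i) = vs ! (Suc i mod k)"
      by auto
    have pow: "(f ^^ i) (vs ! 0) = vs ! (i mod k)" for i
    proof (induction i)
      case (Suc i)
      have "(f ^^ Suc i) (vs ! 0) = f (vs ! (i mod k))"
        by (simp add: Suc)
      also have "\<dots> = vs ! (Suc (i mod k) mod k)"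
        using k by (intro vs(5)) simp
      finally show ?case by (simp add: mod_Suc_eq)
    qed simp
    have "orbit f (vs ! 0) = {(f ^^ m) (vs ! 0) |m. m < k}"
      by (rule orbit_altdef_bounded) (use pow[of k] k in simp_all)
    also have "\<dots> = set vs"
      using pow vs(2) by (auto simp: set_conv_nth) (metis mod_less)
    finally have "cyclic_on f C"
      using k vs(1,2) unfolding cyclic_on_def by (intro bexI[of _ "vs ! 0"]) auto
    then show "C \<in> {C \<in> cycles_within B f. card C = k}"
      using vs distinct_card[OF vs(3)] by (simp add: cycles_within_def)
  qed
  then show ?thesis
    unfolding directed_cycles_def by (simp only: setcompr_eq_image image_image)
qed

lemma card_directed_cycles:
  assumes "k > 0"
  shows "card (directed_cycles B f k) = card {C \<in> cycles_within B f. card C = k}"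
proof -
  have inj: "inj (\<lambda>C. (\<lambda>v. (v, f v)) ` C)"
    by (rule inj_on_inverseI[of _ "(`) fst"]) (simp add: image_image)
  show ?thesis
    unfolding directed_cycles_eq[OF assms]
    by (rule card_image) (rule inj_on_subset[OF inj subset_UNIV])
qed

context
  fixes n :: nat and E :: "nat set set" and B :: "nat set" and f :: "nat \<Rightarrow> nat"
  assumes G: "simple_graph n E" "bipartite_graph n E"
    and B: "B \<subseteq> {1..n}" and f: "f \<in> orientations E B"
begin

lemma orientation_loop_free: "v \<in> B \<Longrightarrow> f v \<noteq> v"
  using simple_graph_edge(3)[OF G(1) orientation_edge[OF f]] by metis

lemma even_card_cycle:
  assumes "C \<in> cycles_within B f"
  shows "even (card C)"
proof -
  have C: "C \<subseteq> B" "cyclic_on f C"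
    using assms by (auto simp: cycles_within_def)
  show ?thesis
    by (rule even_card_bipartite[OF G(2) finite_cyclic_on[OF C(2)], of f])
      (use cyclic_on_image_eq[OF C(2)] C(1) orientation_edge[OF f] in auto)
qed

lemma orientation_type_eq:
  defines "c \<equiv> \<lambda>k. card {C \<in> cycles_within B f. card C = k}"
  shows "orientation_type n E B f =
    replicate_mset (n - 2 * c 2 - (\<Sum>j = 2..n. 2 * j * c (2 * j))) 1 + replicate_mset (c 2) 2 +
    (\<Sum>j = 2..n. replicate_mset (c (2 * j)) (2 * j))"
proof -
  have "card (directed_cycles B f (2 * j)) = c (2 * j)" if "j \<in> {2..n}" for j
    unfolding c_def using that by (intro card_directed_cycles) simp
  then have "(\<Sum>j = 2..n. 2 * j * card (directed_cycles B f (2 * j))) =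
      (\<Sum>j = 2..n. 2 * j * c (2 * j))"
    and "(\<Sum>j = 2..n. replicate_mset (card (directed_cycles B f (2 * j))) (2 * j)) =
      (\<Sum>j = 2..n. replicate_mset (c (2 * j)) (2 * j))"
    by (auto intro!: sum.cong)
  moreover have "card (bidirected_edges E B f) = c 2"
    unfolding c_def bidirected_edges_eq[OF G(1) f] ..
  ultimately show ?thesis
    unfolding orientation_type_def Let_def by simp
qed

lemma count_orientation_type:
  assumes k: "k \<in> {2..n}"
  shows "count (orientation_type n E B f) k = card {C \<in> cycles_within B f. card C = k}"
proof -
  define c where "c k = card {C \<in> cycles_within B f. card C = k}" for k
  have count: "count (orientation_type n E B f) k =
      (if k = 2 then c 2 else 0) + (\<Sum>j = 2..n. if k = 2 * j then c (2 * j) else 0)"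
    unfolding orientation_type_eq c_def[symmetric] using k by (auto simp: count_sum)
  also have "\<dots> = c k"
  proof (cases "even k")
    case True
    then obtain i where i: "k = 2 * i" by auto
    have "(\<Sum>j = 2..n. if k = 2 * j then c (2 * j) else 0) = (\<Sum>j = 2..n. if j = i then c k else 0)"
      using i by (intro sum.cong) auto
    then show ?thesis
      using k i by (cases "i = 1") auto
  next
    case False
    then have "{C \<in> cycles_within B f. card C = k} = {}"
      using even_card_cycle by auto
    then have "c k = 0"
      by (simp only: c_def card.empty)
    moreover have "(\<Sum>j = 2..n. if k = 2 * j then c (2 * j) else 0) = 0"
      using False by (intro sum.neutral) auto
    ultimately show ?thesis
      using False by auto
  qed
  finally show ?thesis by (simp add: c_def)
qed

text \<open>The cycles are disjoint subsets of \<open>{1..n}\<close> and have even lengths, so the truncated subtractions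
  in the number of parts equal to 1 are genuine.\<close>

lemma orientation_type_in_partitions: "orientation_type n E B f \<in> partitions n"
proof -
  let ?Cyc = "cycles_within B f"
  define c where "c k = card {C \<in> ?Cyc. card C = k}" for k
  have fin: "finite ?Cyc"
    using B orientation_loop_free by (rule finite_cycles_within)
  \<comment> \<open>Bidirected edges are the cycles of half-length 1, so the two contributions to the type are
    treated alike.\<close>
  have half: "card C div 2 \<in> insert 1 {2..n}" if "C \<in> ?Cyc" for C
    using card_cycle_bounds[OF B orientation_loop_free that] by auto
  have even: "card C div 2 = j \<longleftrightarrow> card C = 2 * j" if "C \<in> ?Cyc" for C j
    using even_card_cycle[OF that] by auto
  have "(\<Sum>C\<in>?Cyc. card C) = (\<Sum>j\<in>insert 1 {2..n}. \<Sum>C\<in>{C \<in> ?Cyc. card C div 2 = j}. card C)"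
    by (rule sum.group[symmetric, OF fin]) (use half in \<open>blast+\<close>)
  also have "\<dots> = (\<Sum>j\<in>insert 1 {2..n}. 2 * j * c (2 * j))"
  proof (intro sum.cong refl)
    fix j
    have "{C \<in> ?Cyc. card C div 2 = j} = {C \<in> ?Cyc. card C = 2 * j}"
      using even by auto
    then show "(\<Sum>C\<in>{C \<in> ?Cyc. card C div 2 = j}. card C) = 2 * j * c (2 * j)"
      by (simp add: c_def)
  qed
  also have "\<dots> = 2 * c 2 + (\<Sum>j = 2..n. 2 * j * c (2 * j))"
    by simp
  finally have "2 * c 2 + (\<Sum>j = 2..n. 2 * j * c (2 * j)) = card (\<Union>?Cyc)"
    using sum_card_cycles[OF B orientation_loop_free] by simp
  also have "\<dots> \<le> n"
    using card_Union_cycles_le[OF B orientation_loop_free] by simp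
  finally have le: "2 * c 2 + (\<Sum>j = 2..n. 2 * j * c (2 * j)) \<le> n" .
  have "sum_mset (\<Sum>j\<in>J. replicate_mset (c (2 * j)) (2 * j)) = (\<Sum>j\<in>J. 2 * j * c (2 * j))"
    for J :: "nat set"
    by (induction J rule: infinite_finite_induct) auto
  then have "sum_mset (orientation_type n E B f) = n"
    using le unfolding orientation_type_eq c_def[symmetric] by simp
  moreover have "0 \<notin># orientation_type n E B f"
    unfolding orientation_type_eq by (auto simp: set_mset_sum split: if_splits)
  ultimately show ?thesis
    by (simp add: partitions_def)
qed

lemma alpha_orientation_type:
  "alpha n lam (orientation_type n E B f) = (\<Sum>\<psi>\<in>sub_permutations n B f. irr_char n lam \<psi>)"
proof -
  have "partition_binomial n (orientation_type n E B f) \<nu> =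
      (\<Prod>j = 2..n. card {C \<in> cycles_within B f. card C = j} choose count \<nu> j)" for \<nu>
    unfolding partition_binomial_def by (intro prod.cong refl) (simp only: count_orientation_type)
  then have "alpha n lam (orientation_type n E B f) =
      (\<Sum>\<nu>\<in>partitions n. irr_char_type n lam \<nu> *
        of_nat (\<Prod>j = 2..n. card {C \<in> cycles_within B f. card C = j} choose count \<nu> j))"
    unfolding alpha_def by simp
  also have "\<dots> = (\<Sum>\<psi>\<in>sub_permutations n B f. irr_char n lam \<psi>)"
    by (rule sum_irr_char_sub_permutations[OF B orientation_loop_free, symmetric])
  finally show ?thesis .
qed

end

section \<open>The immanantal polynomial of the Laplacian\<close>

text \<open>An orientation compatible with \<open>\<psi>\<close> has its arrows prescribed on the points that \<open>\<psi>\<close> moves and is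
  free elsewhere. The product is, up to sign, that of the Laplacian entries \<open>(i, \<psi> i)\<close> with \<open>i \<in> B\<close>.\<close>

lemma card_orientations_extending:
  assumes G: "simple_graph n E" and \<psi>: "\<psi> permutes {1..n}" and B: "B \<subseteq> {1..n}"
  shows "card {f \<in> orientations E B. \<psi> \<in> sub_permutations n B f} =
    (if {i. \<psi> i \<noteq> i} \<subseteq> B
     then \<Prod>i\<in>B. if \<psi> i = i then card (neighbours E i) else if {i, \<psi> i} \<in> E then 1 else 0
     else 0)"
proof (cases "{i. \<psi> i \<noteq> i} \<subseteq> B")
  case True
  let ?N = "\<lambda>i. if \<psi> i = i then neighbours E i else {\<psi> i} \<inter> neighbours E i"
  have "{f \<in> orientations E B. \<psi> \<in> sub_permutations n B f} = PiE B ?N"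
  proof (intro equalityI subsetI)
    fix f assume "f \<in> {f \<in> orientations E B. \<psi> \<in> sub_permutations n B f}"
    then show "f \<in> PiE B ?N"
      by (auto simp: orientations_def sub_permutations_def PiE_iff)
  next
    fix f assume f: "f \<in> PiE B ?N"
    have "f i \<in> neighbours E i" "\<psi> i \<noteq> i \<longrightarrow> \<psi> i = f i" if "i \<in> B" for i
      using PiE_mem[OF f that] by (auto split: if_splits)
    then show "f \<in> {f \<in> orientations E B. \<psi> \<in> sub_permutations n B f}"
      using f True \<psi> by (auto simp: orientations_def sub_permutations_def PiE_def)
  qed
  then have "card {f \<in> orientations E B. \<psi> \<in> sub_permutations n B f} = (\<Prod>i\<in>B. card (?N i))"
    using finite_subset[OF B] by (simp add: card_PiE)
  also have "\<dots> = (\<Prod>i\<in>B. if \<psi> i = i then card (neighbours E i)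
      else if {i, \<psi> i} \<in> E then 1 else 0)"
    by (intro prod.cong refl) (auto simp: neighbours_def)
  finally show ?thesis
    using True by simp
next
  case False
  then have "{f \<in> orientations E B. \<psi> \<in> sub_permutations n B f} = {}"
    by (auto simp: sub_permutations_def)
  then have "card {f \<in> orientations E B. \<psi> \<in> sub_permutations n B f} = 0"
    by (simp only: card.empty)
  then show ?thesis
    using False by (simp only: if_False)
qed

text \<open>Expanding the product, \<open>B\<close> is the set of rows in which the Laplacian entry is taken instead of \<open>x\<close>.
  The \<open>x\<close> is only available at fixed points of \<open>\<psi>\<close>, so all moved points lie in \<open>B\<close>. The entries
  at moved points are \<open>-1\<close> unless the product vanishes, and these signs cancel: along edges of a bipartite graph the number of moved
  points is even.\<close>

lemma prod_x_minus_laplacian: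
  assumes G: "simple_graph n E" "bipartite_graph n E" and \<psi>: "\<psi> permutes {1..n}"
  shows "(\<Prod>i = 1..n. x_minus x (laplacian E) i (\<psi> i)) =
    (\<Sum>B\<in>Pow {1..n}. (-1) ^ card B * x ^ (n - card B) *
       of_nat (card {f \<in> orientations E B. \<psi> \<in> sub_permutations n B f}))"
proof -
  let ?L = "laplacian E" and ?M = "{i. \<psi> i \<noteq> i}"
  define w where "w = (\<lambda>i. if \<psi> i = i then card (neighbours E i)
    else if {i, \<psi> i} \<in> E then 1 else 0)"
  have M: "?M \<subseteq> {1..n}"
    using permutes_not_in[OF \<psi>] by blast
  have L: "?L i (\<psi> i) = (if \<psi> i = i then 1 else - 1) * of_nat (w i)" for i
  proof -
    have "{i} \<notin> E"
      using simple_graph_edge(3)[OF G(1), of i i] by auto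
    then show ?thesis
      by (auto simp: laplacian_def degree_matrix_def adjacency_def w_def)
  qed
  have factor: "(\<Prod>i\<in>B. ?L i (\<psi> i)) * (\<Prod>i\<in>{1..n} - B. if i = \<psi> i then x else 0) =
      x ^ (n - card B) * of_nat (card {f \<in> orientations E B. \<psi> \<in> sub_permutations n B f})"
    if B: "B \<subseteq> {1..n}" for B
  proof (cases "?M \<subseteq> B")
    case False
    then have "(\<Prod>i\<in>{1..n} - B. if i = \<psi> i then x else 0) = 0"
      using M by (intro prod_zero) (auto intro!: bexI)
    then show ?thesis
      using False by (simp add: card_orientations_extending[OF G(1) \<psi> B])
  next
    case True
    have fin: "finite B"
      using B finite_subset by blast
    have "(\<Prod>i\<in>{1..n} - B. if i = \<psi> i then x else 0) = (\<Prod>i\<in>{1..n} - B. x)"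
    proof (intro prod.cong refl)
      fix i assume "i \<in> {1..n} - B"
      then have "i = \<psi> i"
        using True by (metis (mono_tags) DiffD2 mem_Collect_eq subsetD)
      then show "(if i = \<psi> i then x else 0) = x"
        by simp
    qed
    then have X: "(\<Prod>i\<in>{1..n} - B. if i = \<psi> i then x else 0) = x ^ (n - card B)"
      using B fin by (simp add: card_Diff_subset)
    have "(\<Prod>i\<in>B. if \<psi> i = i then 1 else - 1 :: complex) = (\<Prod>i\<in>?M. - 1)"
      using True fin by (intro prod.mono_neutral_cong_right) auto
    then have "(\<Prod>i\<in>B. ?L i (\<psi> i)) = (- 1) ^ card ?M * of_nat (\<Prod>i\<in>B. w i)"
      by (simp add: L prod.distrib)
    also have "\<dots> = of_nat (\<Prod>i\<in>B. w i)"
    proof (cases "\<forall>i\<in>?M. {i, \<psi> i} \<in> E")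
      case True
      have "even (card ?M)"
      proof (rule even_card_bipartite[OF G(2), of _ \<psi>])
        show "finite ?M" using M finite_subset by blast
        show "inj_on \<psi> ?M" "\<psi> ` ?M \<subseteq> ?M"
          using permutes_inj[OF \<psi>] by (auto simp: inj_on_def inj_def)
      qed (use True in auto)
      then show ?thesis by simp
    next
      case False
      then have "(\<Prod>i\<in>B. w i) = 0"
        using \<open>?M \<subseteq> B\<close> fin by (intro prod_zero) (auto simp: w_def)
      then show ?thesis by simp
    qed
    also have "(\<Prod>i\<in>B. w i) = card {f \<in> orientations E B. \<psi> \<in> sub_permutations n B f}"
      using True by (simp add: card_orientations_extending[OF G(1) \<psi> B] w_def)
    finally show ?thesis
      unfolding X by simp
  qed
  have "(\<Prod>i = 1..n. x_minus x ?L i (\<psi> i)) =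
      (\<Prod>i = 1..n. (if i = \<psi> i then x else 0) - ?L i (\<psi> i))"
    by (simp add: x_minus_def)
  also have "\<dots> = (\<Sum>B\<in>Pow {1..n}. (-1) ^ card B * (\<Prod>i\<in>B. ?L i (\<psi> i)) *
      (\<Prod>i\<in>{1..n} - B. if i = \<psi> i then x else 0))"
    by (rule prod_diff_conv_sum) simp
  also have "\<dots> = (\<Sum>B\<in>Pow {1..n}. (-1) ^ card B * x ^ (n - card B) *
       of_nat (card {f \<in> orientations E B. \<psi> \<in> sub_permutations n B f}))"
    using factor by (intro sum.cong refl) (simp add: mult.assoc)
  finally show ?thesis .
qed

lemma sum_over_orientations_swap:
  assumes G: "simple_graph n E" and B: "B \<subseteq> {1..n}"
  shows "(\<Sum>\<psi> | \<psi> permutes {1..n}.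
      h \<psi> * of_nat (card {f \<in> orientations E B. \<psi> \<in> sub_permutations n B f})) =
    (\<Sum>f\<in>orientations E B. \<Sum>\<psi>\<in>sub_permutations n B f. h \<psi> :: complex)"
proof -
  let ?P = "{\<psi>. \<psi> permutes {1..n}}" and ?O = "orientations E B"
  have fin: "finite ?P" "finite ?O"
    using finite_permutations finite_orientations[OF G B] by auto
  have "(\<Sum>\<psi>\<in>?P. h \<psi> * of_nat (card {f \<in> ?O. \<psi> \<in> sub_permutations n B f})) =
      (\<Sum>\<psi>\<in>?P. \<Sum>f\<in>?O. if \<psi> \<in> sub_permutations n B f then h \<psi> else 0)"
    using fin by (intro sum.cong refl) (simp add: sum.If_cases Int_def mult.commute)
  also have "\<dots> = (\<Sum>f\<in>?O. \<Sum>\<psi>\<in>?P. if \<psi> \<in> sub_permutations n B f then h \<psi> else 0)"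
    by (rule sum.swap)
  also have "\<dots> = (\<Sum>f\<in>?O. \<Sum>\<psi>\<in>sub_permutations n B f. h \<psi>)"
    using fin by (intro sum.cong refl sum.mono_neutral_cong_right) (auto simp: sub_permutations_def)
  finally show ?thesis .
qed

lemma sum_in_Nats: "(\<And>i. i \<in> I \<Longrightarrow> g i \<in> \<nat>) \<Longrightarrow> sum g I \<in> \<nat>"
  by (induction I rule: infinite_finite_induct) auto

lemma imm_coeff_laplacian:
  assumes G: "simple_graph n E" "bipartite_graph n E" and r: "r \<le> n"
  shows "imm_coeff n lam (laplacian E) r =
    (\<Sum>B | B \<subseteq> {1..n} \<and> card B = r. \<Sum>f\<in>orientations E B.
       \<Sum>\<psi>\<in>sub_permutations n B f. irr_char n lam \<psi>)"
proof -
  define S where "S = (\<lambda>B. \<Sum>f\<in>orientations E B. \<Sum>\<psi>\<in>sub_permutations n B f. irr_char n lam \<psi>)"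
  define b where "b = (\<lambda>r. if r \<le> n then \<Sum>B | B \<subseteq> {1..n} \<and> card B = r. S B else 0)"
  have "imm n lam (x_minus x (laplacian E)) = (\<Sum>r = 0..n. (-1) ^ r * b r * x ^ (n - r))" for x
  proof -
    have "imm n lam (x_minus x (laplacian E)) =
        (\<Sum>\<psi> | \<psi> permutes {1..n}. \<Sum>B\<in>Pow {1..n}. (-1) ^ card B * x ^ (n - card B) *
          (irr_char n lam \<psi> *
            of_nat (card {f \<in> orientations E B. \<psi> \<in> sub_permutations n B f})))"
      unfolding imm_def
      by (intro sum.cong refl)
        (simp only: mem_Collect_eq prod_x_minus_laplacian[OF G] sum_distrib_left mult_ac)
    also have "\<dots> = (\<Sum>B\<in>Pow {1..n}. (-1) ^ card B * x ^ (n - card B) * S B)"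
      by (subst sum.swap)
        (simp add: S_def sum_over_orientations_swap[OF G(1), symmetric] sum_distrib_left[symmetric])
    also have "\<dots> = (\<Sum>r = 0..n. \<Sum>B\<in>{B \<in> Pow {1..n}. card B = r}.
        (-1) ^ card B * x ^ (n - card B) * S B)"
      using card_mono[of "{1..n}"] by (intro sum.group[symmetric]) fastforce+
    also have "\<dots> = (\<Sum>r = 0..n. (-1) ^ r * b r * x ^ (n - r))"
    proof (intro sum.cong refl)
      fix r assume "r \<in> {0..n}"
      then have "b r = (\<Sum>B\<in>{B \<in> Pow {1..n}. card B = r}. S B)"
        by (simp add: b_def)
      then show "(\<Sum>B\<in>{B \<in> Pow {1..n}. card B = r}. (-1) ^ card B * x ^ (n - card B) * S B) =
          (-1) ^ r * b r * x ^ (n - r)"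
        by (simp add: sum_distrib_left sum_distrib_right mult_ac)
    qed
    finally show ?thesis .
  qed
  then have "imm_coeff n lam (laplacian E) = b"
    unfolding imm_coeff_def
    by (intro the1_equality imm_coeff_unique_existence) (simp add: b_def)
  then show ?thesis
    using r by (simp add: b_def S_def)
qed

theorem lemma9:
  fixes n r :: nat and E :: "nat set set" and lam :: "nat multiset"
  assumes "simple_graph n E" "connected_graph n E" "bipartite_graph n E"
    and "lam \<in> partitions n" "r \<le> n"
  shows "imm_coeff n lam (laplacian E) r =
           (\<Sum>\<mu>\<in>partitions n. of_nat (orientation_count n E r \<mu>) * alpha n lam \<mu>) \<and>
         imm_coeff n lam (laplacian E) r \<in> \<nat>"
proof
  note G = assms(1,3)
  note coeff = imm_coeff_laplacian[OF G assms(5)]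
  let ?Bs = "{B. B \<subseteq> {1..n} \<and> card B = r}"
  have type: "(\<Sum>\<mu>\<in>partitions n.
        of_nat (card {f \<in> orientations E B. orientation_type n E B f = \<mu>}) * alpha n lam \<mu>) =
      (\<Sum>f\<in>orientations E B. \<Sum>\<psi>\<in>sub_permutations n B f. irr_char n lam \<psi>)"
    if B: "B \<in> ?Bs" for B
  proof -
    let ?O = "orientations E B" and ?type = "orientation_type n E B"
    have "(\<Sum>\<mu>\<in>partitions n. of_nat (card {f \<in> ?O. ?type f = \<mu>}) * alpha n lam \<mu>) =
        (\<Sum>\<mu>\<in>partitions n. \<Sum>f\<in>{f \<in> ?O. ?type f = \<mu>}. alpha n lam (?type f))"
      by (intro sum.cong refl) simp
    also have "\<dots> = (\<Sum>f\<in>?O. alpha n lam (?type f))"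
      using B finite_orientations[OF G(1)] finite_partitions orientation_type_in_partitions[OF G]
      by (intro sum.group) auto
    also have "\<dots> = (\<Sum>f\<in>?O. \<Sum>\<psi>\<in>sub_permutations n B f. irr_char n lam \<psi>)"
      using B by (intro sum.cong refl alpha_orientation_type[OF G]) auto
    finally show ?thesis .
  qed
  have "(\<Sum>\<mu>\<in>partitions n. of_nat (orientation_count n E r \<mu>) * alpha n lam \<mu>) =
      (\<Sum>B\<in>?Bs. \<Sum>\<mu>\<in>partitions n.
        of_nat (card {f \<in> orientations E B. orientation_type n E B f = \<mu>}) * alpha n lam \<mu>)"
    unfolding orientation_count_def of_nat_sum sum_distrib_right by (rule sum.swap)
  also have "\<dots> = imm_coeff n lam (laplacian E) r"
    unfolding coeff by (intro sum.cong refl type)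
  finally show "imm_coeff n lam (laplacian E) r =
      (\<Sum>\<mu>\<in>partitions n. of_nat (orientation_count n E r \<mu>) * alpha n lam \<mu>)" ..
  show "imm_coeff n lam (laplacian E) r \<in> \<nat>"
    unfolding coeff
    by (intro sum_in_Nats sum_irr_char_sub_permutations_in_Nats)
      (use orientation_loop_free[OF G] in auto)
qed

end
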